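(* Let $A\in\mathbb{R}^{m\times n}$, $m\ge n$, have smallest singular value $\sigma_{\min}$, and let $[a,b]\subset[\sigma_{\min},\|A\|]$ with $0<a<b$. Let $P_{S_A}$ be the spectral projector of $S_A$ associated with $[a,b]$ and let $P=\phi_d(l(S_A))$ be its degree-$d$ Chebyshev--Jackson approximation (both defined in the context). Let $$\alpha=\arccos(l(a)),\quad \beta=\arccos(l(b)),$$ $$\Delta_{il}=|\arccos(l(\sigma_{il}))-\alpha|,\quad \Delta_{ir}=|\arccos(l(\sigma_{ir}))-\beta|,\quad \Delta_{ol}=|\arccos(l(\sigma_{ol}))-\alpha|,\quad \Delta_{or}=|\arccos(l(\sigma_{or}))-\beta|,$$ where $\sigma_{il},\sigma_{ir}$ are the singular values of $A$ in $(a,b)$ closest to $a$ and to $b$, respectively, $\sigma_{ol}$ is the singular value of $A$ less than $a$ closest to $a$, and $\sigma_{or}$ is the singular value of $A$ greater than $b$ closest to $b$ (all assumed to exist). Put $\Delta_{\min}=\min\{\Delta_{il},\Delta_{ir},\Delta_{ol},\Delta_{or}\}$. Then $$\|P_{S_A}-P\|\le\frac{\pi^6}{2(d+2)^3\Delta_{\min}^4}.$$ Let $\mathcal{L}=\{\pm\sigma_1,\ldots,\pm\sigma_n,0,\ldots,0\}$ (with $m-n$ zeros) be the spectrum of $S_A$ counted with multiplicity, where $\sigma_1,\ldots,\sigma_n$ are the singular values of $A$, labeled so that exactly $\sigma_1,\ldots,\sigma_{n_{sv}}$ lie in $[a,b]$, with $\sigma_1,\ldots,\sigma_r\in(a,b)$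 and $\sigma_{r+1},\ldots,\sigma_{n_{sv}}\in\{a,b\}$. Let $\gamma_i=\phi_d(l(\sigma_i))$, $i=1,\ldots,n_{sv}$, the labeling being such that these are in decreasing order within $\{1,\ldots,r\}$ and within $\{r+1,\ldots,n_{sv}\}$. Let $\mathcal{L}^c_{n_{sv}}=\mathcal{L}\setminus\{\sigma_1,\ldots,\sigma_{n_{sv}}\}$ (as multisets) and label the eigenvalues $\phi_d(l(\lambda))$, $\lambda\in\mathcal{L}^c_{n_{sv}}$, of $P$ as $\gamma_{n_{sv}+1}\ge\gamma_{n_{sv}+2}\ge\cdots\ge\gamma_{m+n}$. If $$d>\frac{\sqrt[3]{2}\,\pi^2}{\Delta_{\min}^{4/3}}-2,$$ then $$\|P_{S_A}-P\|<\frac14$$ and $$1\ge\gamma_1\ge\cdots\ge\gamma_r>\frac34>\gamma_{r+1}\ge\cdots\ge\gamma_{n_{sv}}>\frac14>\gamma_{n_{sv}+1}\ge\cdots\ge\gamma_{m+n}\ge 0.$$ (If $r=n_{sv}$, the terms $\gamma_{r+1},\ldots,\gamma_{n_{sv}}$ are absent.)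
   Context: $\|\cdot\|$ is the 2-norm. $S_A=\begin{bmatrix}0 & A^T \\ A & 0\end{bmatrix}\in\mathbb{R}^{(m+n)\times(m+n)}$. With the SVD $A=U\begin{pmatrix}\Sigma \\ 0\end{pmatrix}V^T$ ($U\in\mathbb{R}^{m\times m}$, $V\in\mathbb{R}^{n\times n}$ orthogonal, $\Sigma$ diagonal with the singular values of $A$) and $U=[U_n\,|\,\hat U]$ with $U_n$ having $n$ columns, the orthogonal matrix $Q=\frac1{\sqrt2}\begin{bmatrix}V & V & 0 \\ U_n & -U_n & \sqrt2\,\hat U\end{bmatrix}$ satisfies $Q^TS_AQ=\mathrm{diag}(\Sigma,-\Sigma,0,\ldots,0)$ with $m-n$ zeros. Spectral projector: $P_{S_A}=Q_{in}Q_{in}^T+\frac12Q_{ab}Q_{ab}^T$, where $Q_{in}$ consists of the columns of $Q$ belonging to eigenvalues of $S_A$ in $(a,b)$ and $Q_{ab}$ of those belonging to eigenvalues equal to $a$ or $b$. Chebyshev--Jackson approximation: $l(x)=x/\|A\|$. For an integer degree $d\ge0$, $\phi_d(x)=\sum_{j=0}^d\rho_{j,d}c_jT_j(x)$, where $T_j$ is the degree-$j$ Chebyshev polynomial of the first kind, $$c_0=\tfrac1\pi(\arccos(l(a))-\arccos(l(b))),\qquad c_j=\tfrac2\pi\,\frac{\sin(j\arccos(l(a)))-\sin(j\arccos(l(b)))}{j}\ (j>0),$$ $$\rho_{j,d}=\frac{(d+2-j)\sin(\frac{\pi}{d+2})\cos(\frac{j\pi}{d+2})+\cos(\frac{\pi}{d+2})\sin(\frac{j\pi}{d+2})}{(d+2)\sin\frac{\pi}{d+2}}.$$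 $P=\phi_d(l(S_A))=\sum_{j=0}^d\rho_{j,d}c_jT_j(l(S_A))$; it has eigenvector matrix $Q$ and eigenvalues $\phi_d(l(\lambda))$ for $\lambda$ in the spectrum of $S_A$. *)

theory Defs
  imports
    "HOL-Analysis.Analysis"
    "HOL-Computational_Algebra.Polynomial"
    "HOL-Library.Multiset"
begin

definition norm2 :: "real^'n^'m \<Rightarrow> real" where
  "norm2 A = onorm ((*v) A)"

text \<open>
  Rows and columns of the augmented matrix are indexed by \<open>'n + 'm\<close>: \<open>Inl\<close> is the leading block
  (size \<open>n\<close>), \<open>Inr\<close> the trailing one (size \<open>m\<close>).
\<close>

definition augmented :: "real^'n^'m \<Rightarrow> real^('n + 'm)^('n + 'm)" where
  "augmented A = (\<chi> p q. case (p, q) of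
      (Inl i, Inr j) \<Rightarrow> transpose A $ i $ j
    | (Inr i, Inl j) \<Rightarrow> A $ i $ j
    | _ \<Rightarrow> 0)"

text \<open>
  Index types carry no order, so "the first \<open>n\<close> of the \<open>m\<close> columns of \<open>U\<close>" is rendered by an injection
  \<open>\<iota> :: 'n \<Rightarrow> 'm\<close>: the columns \<open>\<iota> j\<close> of \<open>U\<close> form \<open>U\<^sub>n\<close> and the columns outside \<open>range \<iota>\<close> form the
  remaining block. \<open>rect_diag \<iota> s\<close> is then the \<open>m\<close>-by-\<open>n\<close> matrix consisting of \<open>diag s\<close> on top of a zero
  block. The singular values are not required to be sorted.
\<close>

definition rect_diag :: "('n \<Rightarrow> 'm) \<Rightarrow> real^'n \<Rightarrow> real^'n^'m" where
  "rect_diag \<iota> s = (\<chi> i j. if i = \<iota> j then s $ j else 0)"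

definition is_svd ::
    "real^'n^'m \<Rightarrow> real^'m^'m \<Rightarrow> ('n \<Rightarrow> 'm) \<Rightarrow> real^'n \<Rightarrow> real^'n^'n \<Rightarrow> bool" where
  "is_svd A U \<iota> s V \<longleftrightarrow>
     inj \<iota> \<and> orthogonal_matrix U \<and> orthogonal_matrix V \<and> (\<forall>j. 0 \<le> s $ j) \<and>
     A = U ** rect_diag \<iota> s ** transpose V"

text \<open>
  The columns of the eigenvector matrix \<open>Q\<close> are again indexed by \<open>'n + 'm\<close>: \<open>Inl j\<close> is the column
  belonging to \<open>s $ j\<close>, \<open>Inr (\<iota> j)\<close> the one belonging to \<open>- s $ j\<close>, and \<open>Inr l\<close> with \<open>l \<notin> range \<iota>\<close> one
  belonging to one of the \<open>m - n\<close> additional zeros.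
\<close>

definition Qmat :: "real^'m^'m \<Rightarrow> ('n \<Rightarrow> 'm) \<Rightarrow> real^'n^'n \<Rightarrow> real^('n + 'm)^('n + 'm)" where
  "Qmat U \<iota> V = (\<chi> p k. 1 / sqrt 2 * (case k of
      Inl j \<Rightarrow> (case p of Inl i \<Rightarrow> V $ i $ j | Inr i \<Rightarrow> U $ i $ \<iota> j)
    | Inr l \<Rightarrow>
        if l \<in> range \<iota>
        then (case p of Inl i \<Rightarrow> V $ i $ inv \<iota> l | Inr i \<Rightarrow> - U $ i $ l)
        else (case p of Inl i \<Rightarrow> 0 | Inr i \<Rightarrow> sqrt 2 * U $ i $ l)))"

definition Qeig :: "('n::finite \<Rightarrow> 'm::finite) \<Rightarrow> real^'n \<Rightarrow> real^('n + 'm)" where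
  "Qeig \<iota> s = (\<chi> k. case k of
      Inl j \<Rightarrow> s $ j
    | Inr l \<Rightarrow> if l \<in> range \<iota> then - s $ inv \<iota> l else 0)"

text \<open>The product \<open>Q\<^sub>K Q\<^sub>K\<^sup>T\<close>, where \<open>Q\<^sub>K\<close> consists of the columns of \<open>Q\<close> with index in \<open>K\<close>.\<close>

definition col_gram :: "real^'k^'p \<Rightarrow> 'k set \<Rightarrow> real^'p^'p" where
  "col_gram Q K = (\<chi> p q. \<Sum>k\<in>K. Q $ p $ k * Q $ q $ k)"

definition spectral_projector ::
    "real^'m^'m \<Rightarrow> ('n \<Rightarrow> 'm) \<Rightarrow> real^'n \<Rightarrow> real^'n^'n \<Rightarrow> real \<Rightarrow> real
      \<Rightarrow> real^('n + 'm)^('n + 'm)" where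
  "spectral_projector U \<iota> s V a b =
     col_gram (Qmat U \<iota> V) {k. a < Qeig \<iota> s $ k \<and> Qeig \<iota> s $ k < b}
     + (1/2) *\<^sub>R col_gram (Qmat U \<iota> V) {k. Qeig \<iota> s $ k = a \<or> Qeig \<iota> s $ k = b}"

fun cheb_poly :: "nat \<Rightarrow> real poly" where
  "cheb_poly 0 = 1"
| "cheb_poly (Suc 0) = [:0, 1:]"
| "cheb_poly (Suc (Suc j)) = [:0, 2:] * cheb_poly (Suc j) - cheb_poly j"

text \<open>The operation \<open>*\<close> on \<open>real^'n^'n\<close> is componentwise, so matrix powers are built from \<open>**\<close>.\<close>

primrec mat_pow :: "real^'n^'n \<Rightarrow> nat \<Rightarrow> real^'n^'n" where
  "mat_pow M 0 = mat 1"
| "mat_pow M (Suc k) = M ** mat_pow M k"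

definition poly_mat :: "real poly \<Rightarrow> real^'n^'n \<Rightarrow> real^'n^'n" where
  "poly_mat p M = (\<Sum>i\<le>degree p. coeff p i *\<^sub>R mat_pow M i)"

definition lscale :: "real^'n^'m \<Rightarrow> real \<Rightarrow> real" where
  "lscale A x = x / norm2 A"

definition cheb_coeff :: "real^'n^'m \<Rightarrow> real \<Rightarrow> real \<Rightarrow> nat \<Rightarrow> real" where
  "cheb_coeff A a b j =
     (if j = 0 then 1 / pi * (arccos (lscale A a) - arccos (lscale A b))
      else 2 / pi * ((sin (real j * arccos (lscale A a)) - sin (real j * arccos (lscale A b)))
                      / real j))"

definition jackson :: "nat \<Rightarrow> nat \<Rightarrow> real" where
  "jackson j d =
     ((real d + 2 - real j) * sin (pi / (real d + 2)) * cos (real j * pi / (real d + 2))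
       + cos (pi / (real d + 2)) * sin (real j * pi / (real d + 2)))
     / ((real d + 2) * sin (pi / (real d + 2)))"

definition cj_fun :: "real^'n^'m \<Rightarrow> real \<Rightarrow> real \<Rightarrow> nat \<Rightarrow> real \<Rightarrow> real" where
  "cj_fun A a b d x = (\<Sum>j=0..d. jackson j d * cheb_coeff A a b j * poly (cheb_poly j) x)"

definition cj_mat :: "real^'n^'m \<Rightarrow> real \<Rightarrow> real \<Rightarrow> nat \<Rightarrow> real^('n + 'm)^('n + 'm)" where
  "cj_mat A a b d =
     (\<Sum>j=0..d. (jackson j d * cheb_coeff A a b j) *\<^sub>R
        poly_mat (cheb_poly j) ((1 / norm2 A) *\<^sub>R augmented A))"

end

theory Submission
  imports Defs
begin

text \<open>
  In the eigenbasis \<open>Q\<close> the projector is \<open>diag (g \<lambda>)\<close>, where \<open>g\<close> is the indicator function of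
  \<open>[a, b]\<close> with the value \<open>1/2\<close> at both jumps, and the approximation is \<open>diag (\<phi> (l \<lambda>))\<close>. Since
  \<open>Q\<close> is orthogonal, the norm of the difference is at most the largest \<open>\<bar>g \<lambda> - \<phi> (l \<lambda>)\<bar>\<close>
  (\<open>norm2_le_of_orthonormal_eigenvectors\<close>), so everything reduces to a pointwise error estimate for
  one scalar function at the points of the spectrum.

  With \<open>x = cos \<theta>\<close> the polynomial \<open>\<phi>\<close> becomes the convolution of the \<open>2\<pi>\<close>-periodic indicator function
  of \<open>\<beta> \<le> \<bar>t\<bar> \<le> \<alpha>\<close> with the Jackson kernel \<open>K t = 1 + 2 \<Sum>\<^sub>j \<rho>\<^sub>j cos (j t)\<close>. This kernel has mean \<open>1\<close>
  and is nonnegative, because up to a factor it is \<open>\<bar>\<Sum>\<^sub>k sin ((k+1) h) exp (i k t)\<bar>\<^sup>2\<close> with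
  \<open>h = \<pi> / (d + 2)\<close> (\<open>jackson_kernel_nonneg\<close>). Hence \<open>0 \<le> \<phi> \<le> 1\<close>, and at distance \<open>D\<close> from the jumps
  the error is at most the mass of \<open>K\<close> outside \<open>[-D, D]\<close>.

  That mass is estimated by Chebyshev's inequality with the weight \<open>(1 - cos t)\<^sup>2\<close>. Only \<open>\<rho>\<^sub>1\<close> and
  \<open>\<rho>\<^sub>2\<close> enter the mean of the weight, which is \<open>(1 - cos h)\<^sup>2 + (sin h)\<^sup>2 / (d + 2) \<le> 2\<pi>\<^sup>2 / (d + 2)\<^sup>3\<close>,
  while \<open>1 - cos D \<ge> 2 D\<^sup>2 / \<pi>\<^sup>2\<close>; the quotient is the bound \<open>\<pi>\<^sup>6 / (2 (d + 2)\<^sup>3 D\<^sup>4)\<close>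
  (\<open>jackson_primitive_tail\<close>).

  Periodic convolution integrals are avoided by working with the odd increasing primitive \<open>F\<close> of
  \<open>K\<close> that satisfies \<open>F (2\<pi> - t) = 2\<pi> - F t\<close>: the value of \<open>\<phi>\<close> at \<open>cos \<theta>\<close> is an explicit combination of
  four values of \<open>F\<close>, and each case of the error estimate is a comparison of these values.

  Once the error is below \<open>1/4\<close>, every eigenvalue of the approximation lies within \<open>1/4\<close> of \<open>1\<close>, \<open>1/2\<close> or
  \<open>0\<close>, which separates the three groups.
\<close>

section \<open>The Jackson kernel and its nonnegativity\<close>

definition jackson_kernel :: "nat \<Rightarrow> real \<Rightarrow> real" where
  "jackson_kernel d t = 1 + 2 * (\<Sum>j=1..d. jackson j d * cos (real j * t))"

text \<open>
  The left-hand side is \<open>\<bar>\<Sum>\<^sub>k a\<^sub>k exp (i k t)\<bar>\<^sup>2\<close>. Expanding the square and collecting the pairs of indices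
  with the same distance \<open>j\<close> gives a cosine polynomial whose coefficients are the autocorrelations of
  \<open>a\<close>. The term \<open>j = n\<close> has an empty inner sum; keeping it makes the induction step uniform.
\<close>

lemma norm_trig_sum_eq_autocorrelation:
  fixes a :: "nat \<Rightarrow> real"
  shows "(\<Sum>k<n. a k * cos (real k * t))\<^sup>2 + (\<Sum>k<n. a k * sin (real k * t))\<^sup>2
    = (\<Sum>k<n. (a k)\<^sup>2) + 2 * (\<Sum>j=1..n. cos (real j * t) * (\<Sum>k<n-j. a k * a (k + j)))"
proof (induction n)
  case 0
  then show ?case by simp
next
  case (Suc n)
  define C where "C = (\<Sum>k<n. a k * cos (real k * t))"
  define S where "S = (\<Sum>k<n. a k * sin (real k * t))"
  have "(\<Sum>j=1..Suc n. cos (real j * t) * (\<Sum>k<Suc n-j. a k * a (k + j)))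
      = (\<Sum>j=1..n. cos (real j * t) * (\<Sum>k<Suc n-j. a k * a (k + j)))"
    by simp
  also have "\<dots> = (\<Sum>j=1..n. cos (real j * t) * (\<Sum>k<n-j. a k * a (k + j))
                        + cos (real j * t) * (a (n - j) * a n))"
    by (rule sum.cong) (auto simp: Suc_diff_le algebra_simps)
  also have "\<dots> = (\<Sum>j=1..n. cos (real j * t) * (\<Sum>k<n-j. a k * a (k + j)))
                  + (\<Sum>j=1..n. cos (real j * t) * (a (n - j) * a n))"
    by (rule sum.distrib)
  also have "(\<Sum>j=1..n. cos (real j * t) * (a (n - j) * a n))
      = (\<Sum>k<n. cos (real (n - k) * t) * (a k * a n))"
    by (rule sum.reindex_bij_witness[of _ "\<lambda>k. n - k" "\<lambda>j. n - j"]) auto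
  also have "\<dots> = (\<Sum>k<n. a n * cos (real n * t) * (a k * cos (real k * t))
                        + a n * sin (real n * t) * (a k * sin (real k * t)))"
    by (rule sum.cong) (auto simp: of_nat_diff left_diff_distrib cos_diff algebra_simps)
  also have "\<dots> = a n * cos (real n * t) * C + a n * sin (real n * t) * S"
    by (simp add: C_def S_def sum.distrib sum_distrib_left)
  finally have R: "(\<Sum>j=1..Suc n. cos (real j * t) * (\<Sum>k<Suc n-j. a k * a (k + j)))
    = (\<Sum>j=1..n. cos (real j * t) * (\<Sum>k<n-j. a k * a (k + j)))
      + (a n * cos (real n * t) * C + a n * sin (real n * t) * S)" .
  have "(a n * cos (real n * t))\<^sup>2 + (a n * sin (real n * t))\<^sup>2
      = (a n)\<^sup>2 * ((sin (real n * t))\<^sup>2 + (cos (real n * t))\<^sup>2)"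
    by (simp only: power_mult_distrib) (simp only: algebra_simps)
  then have sq: "(a n * cos (real n * t))\<^sup>2 + (a n * sin (real n * t))\<^sup>2 = (a n)\<^sup>2"
    by simp
  have "(C + a n * cos (real n * t))\<^sup>2 + (S + a n * sin (real n * t))\<^sup>2
     = C\<^sup>2 + S\<^sup>2 + ((a n * cos (real n * t))\<^sup>2 + (a n * sin (real n * t))\<^sup>2)
       + 2 * (a n * cos (real n * t) * C + a n * sin (real n * t) * S)"
    by (simp only: power2_sum) (simp only: algebra_simps)
  then show ?case
    using Suc.IH R sq unfolding C_def[symmetric] S_def[symmetric] by (simp add: C_def[symmetric] S_def[symmetric])
qed

text \<open>
  Each product of sines is half of \<open>cos (j x) - cos ((2 k + 2 + j) x)\<close>, and multiplication by \<open>sin x\<close> makes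
  the second cosine telescope.
\<close>

lemma sum_sin_times_shifted_sin:
  fixes x :: real
  shows "2 * sin x * (\<Sum>k<M. sin (real (Suc k) * x) * sin (real (Suc (k + j)) * x))
    = real M * cos (real j * x) * sin x
      - (sin ((2 * real M + 1 + real j) * x) - sin ((1 + real j) * x)) / 2"
proof (induction M)
  case 0
  then show ?case by simp
next
  case (Suc M)
  define Y where "Y = (2 * real M + 2 + real j) * x"
  have p: "2 * sin (real (Suc M) * x) * sin (real (Suc (M + j)) * x) = cos (real j * x) - cos Y"
  proof -
    have "real j * x = real (Suc (M + j)) * x - real (Suc M) * x"
      "Y = real (Suc (M + j)) * x + real (Suc M) * x"
      by (simp_all add: Y_def algebra_simps)
    then show ?thesis by (simp only: cos_diff cos_add) simp
  qed
  have q: "2 * sin x * cos Y = sin ((2 * real (Suc M) + 1 + real j) * x) - sin ((2 * real M + 1 + real j) * x)"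
  proof -
    have "(2 * real (Suc M) + 1 + real j) * x = Y + x" "(2 * real M + 1 + real j) * x = Y - x"
      by (simp_all add: Y_def algebra_simps)
    then show ?thesis by (simp only: sin_diff sin_add) simp
  qed
  have "2 * sin x * (\<Sum>k<Suc M. sin (real (Suc k) * x) * sin (real (Suc (k + j)) * x))
     = 2 * sin x * (\<Sum>k<M. sin (real (Suc k) * x) * sin (real (Suc (k + j)) * x))
       + sin x * (2 * sin (real (Suc M) * x) * sin (real (Suc (M + j)) * x))"
    by (simp add: distrib_left del: of_nat_Suc)
  also have "\<dots> = real M * cos (real j * x) * sin x
      - (sin ((2 * real M + 1 + real j) * x) - sin ((1 + real j) * x)) / 2
      + sin x * (cos (real j * x) - cos Y)"
    unfolding Suc p by simp
  also have "\<dots> = real (Suc M) * cos (real j * x) * sin x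
      - (sin ((2 * real M + 1 + real j) * x) + 2 * sin x * cos Y - sin ((1 + real j) * x)) / 2"
    by (simp add: algebra_simps add_divide_distrib diff_divide_distrib)
  finally show ?case unfolding q by simp
qed

lemma sin_pi_over_pos: "sin (pi / (real d + 2)) > 0"
  by (rule sin_gt_zero) (auto simp: divide_less_eq)

text \<open>
  The Jackson damping factors are the normalized autocorrelations of the sequence
  \<open>sin x, sin (2 x), \<dots>, sin ((d + 1) x)\<close>. The choice \<open>x = \<pi> / (d + 2)\<close> reflects the upper end of the
  telescoped sum to the negative of its lower end, as the two angles add up to \<open>2\<pi>\<close>.
\<close>

lemma jackson_eq_autocorrelation:
  assumes "j \<le> d"
  defines "x \<equiv> pi / (real d + 2)"
  shows "(\<Sum>k<Suc d - j. sin (real (Suc k) * x) * sin (real (Suc (k + j)) * x))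
    = (real d + 2) / 2 * jackson j d"
proof -
  have sx: "sin x > 0" unfolding x_def by (rule sin_pi_over_pos)
  have "(2 * real (Suc d - j) + 1 + real j) * x = 2 * pi - (1 + real j) * x"
    using assms(1) by (simp add: x_def of_nat_diff Suc_diff_le field_simps)
  then have e: "sin ((2 * real (Suc d - j) + 1 + real j) * x) = - sin ((1 + real j) * x)"
    by (simp only: sin_2pi_minus)
  have e2: "sin ((1 + real j) * x) = sin x * cos (real j * x) + cos x * sin (real j * x)"
    by (simp add: sin_add distrib_right)
  have "2 * sin x * (\<Sum>k<Suc d - j. sin (real (Suc k) * x) * sin (real (Suc (k + j)) * x))
    = real (Suc d - j) * cos (real j * x) * sin x + sin ((1 + real j) * x)"
    unfolding sum_sin_times_shifted_sin e by simp
  also have "\<dots> = (real d + 2 - real j) * sin x * cos (real j * x) + cos x * sin (real j * x)"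
    unfolding e2 using assms(1) by (simp add: of_nat_diff Suc_diff_le algebra_simps)
  also have "\<dots> = (real d + 2) * sin x * jackson j d"
    using sx by (simp add: jackson_def x_def)
  finally have "(2 * sin x) * (\<Sum>k<Suc d - j. sin (real (Suc k) * x) * sin (real (Suc (k + j)) * x))
    = (2 * sin x) * ((real d + 2) / 2 * jackson j d)"
    by (simp only: mult_ac)
  then show ?thesis using sx by (simp only: mult_cancel_left) simp
qed

lemma jackson_0: "jackson 0 d = 1"
  using sin_pi_over_pos[of d] by (simp add: jackson_def)

text \<open>
  By the autocorrelation identities, \<open>(d + 2) / 2\<close> times the kernel is a squared modulus.
\<close>

lemma jackson_kernel_nonneg: "0 \<le> jackson_kernel d t"
proof -
  define x where "x = pi / (real d + 2)"
  define a where "a k = sin (real (Suc k) * x)" for k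
  have aut: "(\<Sum>k<Suc d - j. a k * a (k + j)) = (real d + 2) / 2 * jackson j d" if "j \<le> d" for j
    unfolding a_def x_def by (rule jackson_eq_autocorrelation[OF that])
  have "(\<Sum>k<Suc d. a k * cos (real k * t))\<^sup>2 + (\<Sum>k<Suc d. a k * sin (real k * t))\<^sup>2
    = (\<Sum>k<Suc d. (a k)\<^sup>2)
      + 2 * (\<Sum>j=1..Suc d. cos (real j * t) * (\<Sum>k<Suc d-j. a k * a (k + j)))"
    by (rule norm_trig_sum_eq_autocorrelation)
  also have "(\<Sum>k<Suc d. (a k)\<^sup>2) = (real d + 2) / 2"
    using aut[of 0] by (simp add: power2_eq_square jackson_0)
  also have "(\<Sum>j=1..Suc d. cos (real j * t) * (\<Sum>k<Suc d-j. a k * a (k + j)))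
      = (\<Sum>j=1..d. cos (real j * t) * (\<Sum>k<Suc d-j. a k * a (k + j)))"
    by simp
  also have "\<dots> = (\<Sum>j=1..d. (real d + 2) / 2 * (jackson j d * cos (real j * t)))"
  proof (rule sum.cong[OF refl], goal_cases)
    case (1 j)
    then show ?case using aut[of j] by simp
  qed
  also have "(real d + 2) / 2 + 2 * \<dots> = (real d + 2) / 2 * jackson_kernel d t"
    by (simp only: sum_distrib_left[symmetric] jackson_kernel_def) (simp add: algebra_simps)
  finally have "0 \<le> (real d + 2) / 2 * jackson_kernel d t"
    by (rule subst) (rule sum_power2_ge_zero)
  then show ?thesis by (simp add: zero_le_mult_iff)
qed

text \<open>
  The primitive of the kernel that vanishes at \<open>0\<close>. The kernel has mean \<open>1\<close> over a period, so
  \<open>jackson_primitive d t - t\<close> is periodic.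
\<close>

definition jackson_primitive :: "nat \<Rightarrow> real \<Rightarrow> real" where
  "jackson_primitive d t = t + 2 * (\<Sum>j=1..d. jackson j d * sin (real j * t) / real j)"

lemma jackson_primitive_deriv:
  "(jackson_primitive d has_real_derivative jackson_kernel d t) (at t within X)"
proof -
  have "((\<lambda>t. jackson j d * sin (real j * t) / real j) has_real_derivative
      jackson j d * cos (real j * t)) (at t within X)" if "j \<in> {1..d}" for j
    using that by (auto intro!: derivative_eq_intros)
  then have "((\<lambda>t. t + 2 * (\<Sum>j=1..d. jackson j d * sin (real j * t) / real j)) has_real_derivative
      jackson_kernel d t) (at t within X)"
    unfolding jackson_kernel_def by (intro DERIV_add DERIV_ident DERIV_cmult DERIV_sum) auto
  then show ?thesis by (simp add: jackson_primitive_def[abs_def])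
qed

lemma jackson_primitive_mono: "x \<le> y \<Longrightarrow> jackson_primitive d x \<le> jackson_primitive d y"
  by (rule DERIV_nonneg_imp_nondecreasing[of x y "jackson_primitive d"])
    (auto intro!: exI[of _ "jackson_kernel d _"] jackson_primitive_deriv jackson_kernel_nonneg)

lemma jackson_primitive_0: "jackson_primitive d 0 = 0"
  by (simp add: jackson_primitive_def)

lemma jackson_primitive_minus: "jackson_primitive d (- t) = - jackson_primitive d t"
  by (simp add: jackson_primitive_def sum_negf)

lemma jackson_primitive_pi: "jackson_primitive d pi = pi"
  by (simp add: jackson_primitive_def mult.commute[of _ pi])

lemma jackson_primitive_2pi_minus:
  "jackson_primitive d (2 * pi - t) = 2 * pi - jackson_primitive d t"
proof -
  have "sin (real j * (2 * pi - t)) = - sin (real j * t)" for j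
  proof -
    have "real j * (2 * pi - t) = 2 * pi * real j - real j * t" by (simp add: algebra_simps)
    then show ?thesis by (simp only: sin_diff cos_int_2pin[of "int j", simplified] sin_int_2pin[of "int j", simplified])
  qed
  then show ?thesis by (simp add: jackson_primitive_def sum_negf)
qed

section \<open>The tail of the Jackson kernel\<close>

lemma has_integral_cos_multiple_half_period:
  fixes k :: int
  shows "((\<lambda>t. cos (of_int k * t)) has_integral (if k = 0 then pi else 0)) {0..pi}"
proof (cases "k = 0")
  case True
  then show ?thesis using has_integral_const_real[of "1::real" 0 pi] by simp
next
  case False
  have "((\<lambda>t. cos (of_int k * t)) has_integral
      (sin (of_int k * pi) / of_int k - sin (of_int k * 0) / of_int k)) {0..pi}"
  proof (rule fundamental_theorem_of_calculus)
    fix t :: real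
    have "((\<lambda>t. sin (of_int k * t) / of_int k) has_real_derivative cos (of_int k * t))
        (at t within {0..pi})"
      using False by (auto intro!: derivative_eq_intros)
    then show "((\<lambda>t. sin (of_int k * t) / of_int k) has_vector_derivative cos (of_int k * t))
        (at t within {0..pi})"
      by (simp add: has_real_derivative_iff_has_vector_derivative)
  qed simp
  moreover have "sin (of_int k * pi) = 0"
    by (simp add: sin_zero_iff_int2)
  ultimately show ?thesis using False by simp
qed

text \<open>
  The weight is the trigonometric polynomial \<open>3/2 - 2 cos t + cos (2 t) / 2\<close>, so by orthogonality only the
  frequencies \<open>0\<close>, \<open>1\<close> and \<open>2\<close> contribute.
\<close>

lemma cos_multiple_times_weight_has_integral:
  "((\<lambda>t. cos (real j * t) * (1 - cos t)\<^sup>2) has_integral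
     (if j = 0 then 3 * pi / 2 else if j = 1 then - pi else if j = 2 then pi / 4 else 0)) {0..pi}"
proof -
  let ?k = "int j"
  let ?c = "\<lambda>k::int. if k = 0 then pi else 0"
  have "cos (real j * t) * (1 - cos t)\<^sup>2 =
      3 / 2 * cos (of_int ?k * t) - cos (of_int (?k + 1) * t) - cos (of_int (?k - 1) * t)
      + 1 / 4 * cos (of_int (?k + 2) * t) + 1 / 4 * cos (of_int (?k - 2) * t)" for t :: real
  proof -
    have e: "of_int (?k + 1) * t = real j * t + t" "of_int (?k - 1) * t = real j * t - t"
      "of_int (?k + 2) * t = real j * t + 2 * t" "of_int (?k - 2) * t = real j * t - 2 * t"
      by (simp_all add: algebra_simps)
    show ?thesis
      unfolding e cos_add cos_diff cos_double_cos by (simp add: power2_eq_square algebra_simps)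
  qed
  moreover have "((\<lambda>t. 3 / 2 * cos (of_int ?k * t) - cos (of_int (?k + 1) * t) - cos (of_int (?k - 1) * t)
      + 1 / 4 * cos (of_int (?k + 2) * t) + 1 / 4 * cos (of_int (?k - 2) * t)) has_integral
     (3 / 2 * ?c ?k - ?c (?k + 1) - ?c (?k - 1) + 1 / 4 * ?c (?k + 2) + 1 / 4 * ?c (?k - 2))) {0..pi}"
    by (intro has_integral_add has_integral_diff has_integral_mult_right
        has_integral_cos_multiple_half_period)
  ultimately show ?thesis by (auto split: if_splits)
qed

text \<open>
  The damping factors extend by zero to the indices \<open>d + 1\<close> and \<open>d + 2\<close>. This lets the moment computation
  use the indices \<open>1\<close> and \<open>2\<close> for all \<open>d\<close>, including \<open>d = 0\<close> and \<open>d = 1\<close>.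
\<close>

lemma jackson_Suc_self: "jackson (Suc d) d = 0"
proof -
  define x where "x = pi / (real d + 2)"
  have "real (Suc d) * x + x = (real d + 2) * x" by (simp add: algebra_simps)
  also have "\<dots> = pi" by (simp add: x_def)
  finally have "real (Suc d) * x + x = pi" .
  then have "sin (real (Suc d) * x + x) = 0" by simp
  then have "sin x * cos (real (Suc d) * x) + cos x * sin (real (Suc d) * x) = 0"
    unfolding sin_add by (simp add: algebra_simps)
  then show ?thesis by (simp add: jackson_def x_def)
qed

lemma jackson_Suc_Suc_self: "jackson (Suc (Suc d)) d = 0"
proof -
  have "real (Suc (Suc d)) * pi / (real d + 2) = pi" by (simp add: field_simps)
  then show ?thesis unfolding jackson_def by simp
qed

lemma jackson_1: "jackson 1 d = cos (pi / (real d + 2))"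
proof -
  define x where "x = pi / (real d + 2)"
  have "(real d + 2 - real 1) * sin x * cos x + cos x * sin x = cos x * ((real d + 2) * sin x)"
    by (simp add: algebra_simps)
  then show ?thesis
    using sin_pi_over_pos[of d] by (simp add: jackson_def x_def)
qed

lemma jackson_2:
  fixes d :: nat
  defines "x \<equiv> pi / (real d + 2)"
  shows "jackson 2 d = 2 * (cos x)\<^sup>2 - 1 + 2 * ((sin x)\<^sup>2 / (real d + 2))"
proof -
  have sx: "sin x > 0" unfolding x_def by (rule sin_pi_over_pos)
  have e: "real 2 * pi / (real d + 2) = 2 * x" by (simp add: x_def)
  have "jackson 2 d = (real d * sin x * cos (2 * x) + cos x * sin (2 * x)) / ((real d + 2) * sin x)"
    unfolding jackson_def e by (simp add: x_def)
  also have "\<dots> = (real d * cos (2 * x) + 2 * (cos x)\<^sup>2) / (real d + 2)"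
    using sx by (simp add: sin_double power2_eq_square divide_simps) (simp add: algebra_simps)
  also have "\<dots> = cos (2 * x) + 2 * (((cos x)\<^sup>2 - cos (2 * x)) / (real d + 2))"
    by (simp add: divide_simps) (simp add: algebra_simps)
  also have "(cos x)\<^sup>2 - cos (2 * x) = (sin x)\<^sup>2" by (simp add: cos_double)
  finally show ?thesis by (simp add: cos_double_cos)
qed

lemma jackson_kernel_weight_has_integral:
  fixes d :: nat
  defines "x \<equiv> pi / (real d + 2)"
  shows "((\<lambda>t. jackson_kernel d t * (1 - cos t)\<^sup>2) has_integral
    pi * ((1 - cos x)\<^sup>2 + (sin x)\<^sup>2 / (real d + 2))) {0..pi}"
proof -
  let ?I = "\<lambda>j::nat. if j = 0 then 3 * pi / 2 else if j = 1 then - pi else if j = 2 then pi / 4 else 0"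
  have "((\<lambda>t. cos (real 0 * t) * (1 - cos t)\<^sup>2
        + 2 * (\<Sum>j=1..d. jackson j d * (cos (real j * t) * (1 - cos t)\<^sup>2))) has_integral
      ?I 0 + 2 * (\<Sum>j=1..d. jackson j d * ?I j)) {0..pi}"
    by (intro has_integral_add has_integral_mult_right has_integral_sum finite_atLeastAtMost
        cos_multiple_times_weight_has_integral)
  moreover have "cos (real 0 * t) * (1 - cos t)\<^sup>2
        + 2 * (\<Sum>j=1..d. jackson j d * (cos (real j * t) * (1 - cos t)\<^sup>2))
      = jackson_kernel d t * (1 - cos t)\<^sup>2" for t
    by (simp add: jackson_kernel_def distrib_right sum_distrib_right mult.assoc)
  moreover have "?I 0 + 2 * (\<Sum>j=1..d. jackson j d * ?I j)
      = pi * ((1 - cos x)\<^sup>2 + (sin x)\<^sup>2 / (real d + 2))"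
  proof -
    have "(\<Sum>j=1..d. jackson j d * ?I j) = (\<Sum>j=1..Suc (Suc d). jackson j d * ?I j)"
      by (simp add: jackson_Suc_self jackson_Suc_Suc_self)
    also have "\<dots> = (\<Sum>j\<in>{1,2}. jackson j d * ?I j)"
      by (rule sum.mono_neutral_right) auto
    also have "\<dots> = - pi * jackson 1 d + pi / 4 * jackson 2 d" by simp
    finally have S: "(\<Sum>j=1..d. jackson j d * ?I j) = - pi * jackson 1 d + pi / 4 * jackson 2 d" .
    define q where "q = (sin x)\<^sup>2 / (real d + 2)"
    show ?thesis
      unfolding S jackson_1 jackson_2 x_def[symmetric] q_def[symmetric]
      by (simp add: power2_diff algebra_simps)
  qed
  ultimately show ?thesis by simp
qed

text \<open>
  Both summands are at most \<open>\<pi>\<^sup>2 / (d + 2)\<^sup>3\<close> for \<open>d \<ge> 1\<close>: the first is at most \<open>x\<^sup>4 / 4\<close>, which is small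
  enough once \<open>\<pi>\<^sup>2 \<le> 4 (d + 2)\<close>. This fails for \<open>d = 0\<close>, where the sum is \<open>3/2\<close> and \<open>\<pi>\<^sup>2 \<ge> 6\<close> suffices.
\<close>

lemma jackson_second_moment_le:
  fixes d :: nat
  defines "x \<equiv> pi / (real d + 2)"
  shows "(1 - cos x)\<^sup>2 + (sin x)\<^sup>2 / (real d + 2) \<le> 2 * pi\<^sup>2 / (real d + 2) ^ 3"
proof (cases "d = 0")
  case True
  have "(3::real) * 3 \<le> pi * pi" using pi_gt3 by (intro mult_mono) auto
  with True show ?thesis by (simp add: x_def power2_eq_square)
next
  case False
  define N where "N = real d + 2"
  have N: "N \<ge> 3" using False by (simp add: N_def)
  have xd: "x = pi / N" by (simp add: x_def N_def)
  have x0: "0 \<le> x" using N by (simp add: xd)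
  have half: "0 \<le> sin (x / 2)"
    using N by (intro sin_ge_zero) (auto simp: xd field_simps)
  have "1 - cos x = 2 * (sin (x / 2))\<^sup>2"
    using cos_double_sin[of "x / 2"] by simp
  also have "\<dots> \<le> 2 * (x / 2)\<^sup>2"
    using half x0 by (intro mult_left_mono power_mono sin_x_le_x) auto
  finally have "(1 - cos x)\<^sup>2 \<le> (x\<^sup>2 / 2)\<^sup>2"
    by (intro power_mono) (auto simp: power2_eq_square)
  also have "\<dots> = pi\<^sup>2 / N ^ 3 * (pi\<^sup>2 / (4 * N))"
    using N by (simp add: xd field_simps eval_nat_numeral)
  also have "\<dots> \<le> pi\<^sup>2 / N ^ 3 * 1"
  proof (intro mult_left_mono)
    have "pi * pi \<le> 3.2 * 3.2"
      using pi_approx by (intro mult_mono) auto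
    then show "pi\<^sup>2 / (4 * N) \<le> 1" using N by (simp add: power2_eq_square divide_simps)
  qed (use N in auto)
  finally have 1: "(1 - cos x)\<^sup>2 \<le> pi\<^sup>2 / N ^ 3" by simp
  have "(sin x)\<^sup>2 \<le> x\<^sup>2"
    using abs_sin_x_le_abs_x[of x] by (simp add: abs_le_square_iff)
  then have "(sin x)\<^sup>2 / N \<le> x\<^sup>2 / N" using N by (intro divide_right_mono) auto
  also have "\<dots> = pi\<^sup>2 / N ^ 3" using N by (simp add: xd field_simps eval_nat_numeral)
  finally show ?thesis using 1 by (simp add: N_def)
qed

text \<open>
  Jordan's inequality: the concave function \<open>sin\<close> lies above its chord over \<open>[0, \<pi>/2]\<close>.
\<close>

lemma sin_ge_two_over_pi_times:
  assumes "0 \<le> y" "y \<le> pi / 2"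
  shows "2 / pi * y \<le> sin y"
proof -
  have "convex_on {0..pi/2} (\<lambda>x. - sin x)"
    by (rule f''_ge0_imp_convex[where f' = "\<lambda>x. - cos x" and f'' = sin])
      (auto intro!: derivative_eq_intros sin_ge_zero)
  from convex_onD[OF this, of "2 / pi * y" 0 "pi / 2"] show ?thesis
    using assms by (simp add: field_simps)
qed

lemma one_minus_cos_ge:
  assumes "0 \<le> D" "D \<le> pi"
  shows "2 * D\<^sup>2 / pi\<^sup>2 \<le> 1 - cos D"
proof -
  have "(2 / pi * (D / 2))\<^sup>2 \<le> (sin (D / 2))\<^sup>2"
    using assms by (intro power_mono sin_ge_two_over_pi_times) auto
  moreover have "1 - cos D = 2 * (sin (D / 2))\<^sup>2"
    using cos_double_sin[of "D / 2"] by simp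
  ultimately show ?thesis by (simp add: power_divide)
qed

text \<open>
  Chebyshev's inequality for the kernel: \<open>\<pi> - F D\<close> is its mass on \<open>[D, \<pi>]\<close>, where the weight
  \<open>(1 - cos t)\<^sup>2\<close> is at least \<open>(1 - cos D)\<^sup>2\<close>.
\<close>

lemma jackson_primitive_tail:
  assumes D: "0 < D" "D \<le> pi"
  shows "pi - jackson_primitive d D \<le> pi * (pi ^ 6 / (2 * (real d + 2) ^ 3 * D ^ 4))"
proof -
  define E where "E = (1 - cos (pi / (real d + 2)))\<^sup>2 + (sin (pi / (real d + 2)))\<^sup>2 / (real d + 2)"
  let ?f = "\<lambda>t. jackson_kernel d t * (1 - cos t)\<^sup>2"
  have KI: "(jackson_kernel d has_integral (pi - jackson_primitive d D)) {D..pi}"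
    using fundamental_theorem_of_calculus[of D pi "jackson_primitive d" "jackson_kernel d"] D
      jackson_primitive_deriv
    by (simp add: has_real_derivative_iff_has_vector_derivative jackson_primitive_pi)
  have full: "(?f has_integral pi * E) {0..pi}"
    unfolding E_def by (rule jackson_kernel_weight_has_integral)
  have part: "?f integrable_on {D..pi}"
    using integrable_on_subinterval[of ?f "{0..pi}" D pi] full D by (auto simp: has_integral_integrable)
  have "(1 - cos D)\<^sup>2 * (pi - jackson_primitive d D) \<le> integral {D..pi} ?f"
  proof (rule has_integral_le[OF has_integral_mult_right[OF KI] integrable_integral[OF part]])
    fix t assume t: "t \<in> {D..pi}"
    then have "cos t \<le> cos D" using D by (intro cos_monotone_0_pi_le) auto
    then have "(1 - cos D)\<^sup>2 \<le> (1 - cos t)\<^sup>2" by (intro power_mono) auto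
    then show "(1 - cos D)\<^sup>2 * jackson_kernel d t \<le> ?f t"
      using jackson_kernel_nonneg[of d t] by (simp add: mult.commute mult_left_mono)
  qed
  also have "\<dots> \<le> pi * E"
    using integral_subset_le[of "{D..pi}" "{0..pi}" ?f] part full D jackson_kernel_nonneg
    by (auto simp: has_integral_iff)
  also have "\<dots> \<le> pi * (2 * pi\<^sup>2 / (real d + 2) ^ 3)"
    unfolding E_def by (intro mult_left_mono jackson_second_moment_le) auto
  finally have ub: "(1 - cos D)\<^sup>2 * (pi - jackson_primitive d D) \<le> pi * (2 * pi\<^sup>2 / (real d + 2) ^ 3)" .
  have "(2 * D\<^sup>2 / pi\<^sup>2)\<^sup>2 \<le> (1 - cos D)\<^sup>2"
    using D by (intro power_mono one_minus_cos_ge) auto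
  moreover have "0 \<le> pi - jackson_primitive d D"
    using jackson_primitive_mono[of D pi d] D by (simp add: jackson_primitive_pi)
  ultimately have "(2 * D\<^sup>2 / pi\<^sup>2)\<^sup>2 * (pi - jackson_primitive d D) \<le> pi * (2 * pi\<^sup>2 / (real d + 2) ^ 3)"
    using ub mult_right_mono order_trans by blast
  moreover have "0 < (2 * D\<^sup>2 / pi\<^sup>2)\<^sup>2" using D by simp
  ultimately have "pi - jackson_primitive d D
      \<le> pi * (2 * pi\<^sup>2 / (real d + 2) ^ 3) / (2 * D\<^sup>2 / pi\<^sup>2)\<^sup>2"
    by (simp only: pos_le_divide_eq mult.commute)
  also have "\<dots> = pi * (pi ^ 6 / (2 * (real d + 2) ^ 3 * D ^ 4))"
    using D by (simp add: divide_simps)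
  finally show ?thesis .
qed

section \<open>Smoothing the indicator function of an arc\<close>

text \<open>
  The convolution of the kernel with the \<open>2\<pi>\<close>-periodic indicator function of \<open>\<beta> \<le> \<bar>t\<bar> \<le> \<alpha>\<close>, evaluated at
  \<open>\<theta>\<close>: the arcs \<open>[\<beta>, \<alpha>]\<close> and \<open>[-\<alpha>, -\<beta>]\<close> contribute \<open>F (\<alpha> - \<theta>) - F (\<beta> - \<theta>)\<close> and
  \<open>F (\<alpha> + \<theta>) - F (\<beta> + \<theta>)\<close>.
\<close>

definition jackson_window :: "nat \<Rightarrow> real \<Rightarrow> real \<Rightarrow> real \<Rightarrow> real" where
  "jackson_window d \<alpha> \<beta> \<theta> =
    (jackson_primitive d (\<alpha> + \<theta>) + jackson_primitive d (\<alpha> - \<theta>)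
     - jackson_primitive d (\<beta> + \<theta>) - jackson_primitive d (\<beta> - \<theta>)) / (2 * pi)"

lemma jackson_primitive_before_pi: "t \<le> pi \<Longrightarrow> jackson_primitive d t \<le> pi"
  using jackson_primitive_mono[of t pi d] by (simp add: jackson_primitive_pi)

lemma two_pi_jackson_window:
  "2 * (pi * jackson_window d \<alpha> \<beta> \<theta>) = jackson_primitive d (\<alpha> + \<theta>)
    + jackson_primitive d (\<alpha> - \<theta>) - jackson_primitive d (\<beta> + \<theta>) - jackson_primitive d (\<beta> - \<theta>)"
  by (simp add: jackson_window_def)

text \<open>
  The angles belong to \<open>0 < a < b \<le> \<parallel>A\<parallel>\<close>, hence \<open>\<alpha> \<le> \<pi>/2\<close>. Then \<open>\<alpha> + \<theta> \<le> \<pi>\<close> whenever \<open>\<theta> \<le> \<alpha>\<close>, so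
  that for these \<open>\<theta>\<close> all four arguments stay where \<open>F \<le> \<pi>\<close>.
\<close>

context
  fixes d :: nat and \<alpha> \<beta> :: real
  assumes \<beta>: "0 \<le> \<beta>" and \<beta>\<alpha>: "\<beta> < \<alpha>" and \<alpha>: "\<alpha> \<le> pi / 2"
begin

lemma jackson_window_nonneg: "0 \<le> jackson_window d \<alpha> \<beta> \<theta>"
  using jackson_primitive_mono[of "\<beta> + \<theta>" "\<alpha> + \<theta>" d]
    jackson_primitive_mono[of "\<beta> - \<theta>" "\<alpha> - \<theta>" d] \<beta>\<alpha>
  by (simp add: jackson_window_def)

text \<open>
  The two arcs may be taken together: \<open>F (\<theta> - \<beta>) \<le> F (\<theta> + \<beta>)\<close> bounds the sum by its two terms with
  \<open>\<alpha>\<close>, and these are both at most \<open>\<pi>\<close>, or at most \<open>2\<pi>\<close> and \<open>0\<close>.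
\<close>

lemma jackson_window_le_1:
  assumes "0 \<le> \<theta>" "\<theta> \<le> pi"
  shows "jackson_window d \<alpha> \<beta> \<theta> \<le> 1"
proof -
  let ?F = "jackson_primitive d"
  have "- ?F (\<beta> - \<theta>) = ?F (\<theta> - \<beta>)" using jackson_primitive_minus[of d "\<beta> - \<theta>"] by simp
  moreover have "?F (\<theta> - \<beta>) \<le> ?F (\<beta> + \<theta>)" using \<beta> by (intro jackson_primitive_mono) auto
  moreover have "?F (\<alpha> + \<theta>) + ?F (\<alpha> - \<theta>) \<le> 2 * pi"
  proof (cases "\<alpha> \<le> \<theta>")
    case True
    have "?F (\<alpha> + \<theta>) \<le> ?F (2 * pi)" using assms \<alpha> by (intro jackson_primitive_mono) auto
    moreover have "?F (\<alpha> - \<theta>) \<le> ?F 0" using True by (intro jackson_primitive_mono) auto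
    ultimately show ?thesis
      using jackson_primitive_2pi_minus[of d 0] by (simp add: jackson_primitive_0)
  next
    case False
    have "?F (\<alpha> + \<theta>) \<le> ?F pi" "?F (\<alpha> - \<theta>) \<le> ?F pi"
      using False assms \<alpha> by (auto intro!: jackson_primitive_mono)
    then show ?thesis by (simp add: jackson_primitive_pi)
  qed
  ultimately show ?thesis by (simp add: jackson_window_def)
qed

text \<open>
  The number \<open>\<epsilon>\<close> bounds the fraction of the mass of the kernel that lies outside \<open>[-D, D]\<close>.
\<close>

context
  fixes D \<epsilon> :: real
  assumes D: "0 \<le> D" and tail: "pi - jackson_primitive d D \<le> pi * \<epsilon>"
begin

lemma jackson_primitive_beyond: "D \<le> t \<Longrightarrow> pi - pi * \<epsilon> \<le> jackson_primitive d t"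
  using jackson_primitive_mono[of D t d] tail by simp

lemma jackson_window_inside:
  assumes "D \<le> \<alpha> - \<theta>" "D \<le> \<theta> - \<beta>"
  shows "1 - \<epsilon> \<le> jackson_window d \<alpha> \<beta> \<theta>"
proof -
  let ?F = "jackson_primitive d"
  have "?F (\<beta> + \<theta>) \<le> ?F (\<alpha> + \<theta>)" using \<beta>\<alpha> by (intro jackson_primitive_mono) auto
  moreover have "pi - pi * \<epsilon> \<le> ?F (\<alpha> - \<theta>)" "pi - pi * \<epsilon> \<le> ?F (\<theta> - \<beta>)"
    using assms by (auto intro!: jackson_primitive_beyond)
  ultimately have "2 * pi - 2 * (pi * \<epsilon>) \<le> ?F (\<alpha> + \<theta>) + ?F (\<alpha> - \<theta>) - ?F (\<beta> + \<theta>) - ?F (\<beta> - \<theta>)"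
    using jackson_primitive_minus[of d "\<beta> - \<theta>"] by simp
  then have "pi * (1 - \<epsilon>) \<le> pi * jackson_window d \<alpha> \<beta> \<theta>"
    using two_pi_jackson_window[of d \<alpha> \<beta> \<theta>] by (simp add: right_diff_distrib)
  then show ?thesis by (simp only: mult_le_cancel_left_pos[OF pi_gt_zero])
qed

text \<open>
  From \<open>\<theta>\<close> the arc \<open>[-\<alpha>, -\<beta>]\<close> is reached the other way round the circle,
  at distance \<open>2\<pi> - (\<alpha> + \<theta>)\<close>, which is at least \<open>\<theta> - \<alpha>\<close> since \<open>\<theta> \<le> \<pi>\<close>.
\<close>

lemma jackson_window_above:
  assumes "D \<le> \<theta> - \<alpha>" "\<theta> \<le> pi"
  shows "jackson_window d \<alpha> \<beta> \<theta> \<le> \<epsilon>"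
proof -
  let ?F = "jackson_primitive d"
  have "pi - pi * \<epsilon> \<le> ?F (2 * pi - (\<alpha> + \<theta>))" "pi - pi * \<epsilon> \<le> ?F (\<theta> - \<alpha>)"
    using assms \<alpha> by (auto intro!: jackson_primitive_beyond)
  moreover have "?F (\<theta> - \<beta>) \<le> ?F (\<beta> + \<theta>)" using \<beta> by (intro jackson_primitive_mono) auto
  ultimately have "?F (\<alpha> + \<theta>) + ?F (\<alpha> - \<theta>) - ?F (\<beta> + \<theta>) - ?F (\<beta> - \<theta>) \<le> 2 * (pi * \<epsilon>)"
    using jackson_primitive_minus[of d "\<beta> - \<theta>"] jackson_primitive_minus[of d "\<alpha> - \<theta>"]
      jackson_primitive_2pi_minus[of d "\<alpha> + \<theta>"] by simp
  then have "pi * jackson_window d \<alpha> \<beta> \<theta> \<le> pi * \<epsilon>"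
    using two_pi_jackson_window[of d \<alpha> \<beta> \<theta>] by linarith
  then show ?thesis by (simp only: mult_le_cancel_left_pos[OF pi_gt_zero])
qed

lemma jackson_window_below:
  assumes "D \<le> \<beta> - \<theta>" "0 \<le> \<theta>"
  shows "jackson_window d \<alpha> \<beta> \<theta> \<le> \<epsilon>"
proof -
  let ?F = "jackson_primitive d"
  have "pi - pi * \<epsilon> \<le> ?F (\<beta> + \<theta>)" "pi - pi * \<epsilon> \<le> ?F (\<beta> - \<theta>)"
    using assms by (auto intro!: jackson_primitive_beyond)
  moreover have "?F (\<alpha> + \<theta>) \<le> pi" "?F (\<alpha> - \<theta>) \<le> pi"
    using assms \<alpha> \<beta>\<alpha> D by (auto intro!: jackson_primitive_before_pi)
  ultimately have "?F (\<alpha> + \<theta>) + ?F (\<alpha> - \<theta>) - ?F (\<beta> + \<theta>) - ?F (\<beta> - \<theta>) \<le> 2 * (pi * \<epsilon>)"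
    by simp
  then have "pi * jackson_window d \<alpha> \<beta> \<theta> \<le> pi * \<epsilon>"
    using two_pi_jackson_window[of d \<alpha> \<beta> \<theta>] by linarith
  then show ?thesis by (simp only: mult_le_cancel_left_pos[OF pi_gt_zero])
qed

text \<open>
  At the jump \<open>\<alpha>\<close> the arc \<open>[\<beta>, \<alpha>]\<close> catches one half of the kernel up to the one-sided tail beyond
  \<open>\<alpha> - \<beta>\<close>. The reflected arc catches a part of that same tail, so the value never exceeds \<open>1/2\<close>.
\<close>

lemma jackson_window_at_upper_jump:
  assumes "D \<le> \<alpha> - \<beta>"
  shows "\<bar>jackson_window d \<alpha> \<beta> \<alpha> - 1 / 2\<bar> \<le> \<epsilon> / 2"
proof -
  let ?F = "jackson_primitive d"
  have "pi - pi * \<epsilon> \<le> ?F (\<alpha> - \<beta>)" using assms by (rule jackson_primitive_beyond)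
  moreover have "?F (\<alpha> - \<beta>) \<le> ?F (\<beta> + \<alpha>)" "?F (\<beta> + \<alpha>) \<le> ?F (\<alpha> + \<alpha>)"
    using \<beta> \<beta>\<alpha> by (auto intro!: jackson_primitive_mono)
  moreover have "?F (\<alpha> + \<alpha>) \<le> pi" using \<alpha> by (auto intro!: jackson_primitive_before_pi)
  ultimately have "pi - pi * \<epsilon> \<le> ?F (\<alpha> + \<alpha>) + ?F (\<alpha> - \<alpha>) - ?F (\<beta> + \<alpha>) - ?F (\<beta> - \<alpha>)"
    "?F (\<alpha> + \<alpha>) + ?F (\<alpha> - \<alpha>) - ?F (\<beta> + \<alpha>) - ?F (\<beta> - \<alpha>) \<le> pi"
    using jackson_primitive_minus[of d "\<beta> - \<alpha>"] by (simp_all add: jackson_primitive_0)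
  moreover have "?F (\<alpha> + \<alpha>) + ?F (\<alpha> - \<alpha>) - ?F (\<beta> + \<alpha>) - ?F (\<beta> - \<alpha>) = 2 * pi * jackson_window d \<alpha> \<beta> \<alpha>"
    by (simp add: jackson_window_def)
  ultimately have "pi * (1 - \<epsilon>) \<le> pi * (2 * jackson_window d \<alpha> \<beta> \<alpha>)"
    "pi * (2 * jackson_window d \<alpha> \<beta> \<alpha>) \<le> pi * 1" by (simp_all add: algebra_simps)
  then have "1 - \<epsilon> \<le> 2 * jackson_window d \<alpha> \<beta> \<alpha>" "2 * jackson_window d \<alpha> \<beta> \<alpha> \<le> 1"
    by (simp_all only: mult_le_cancel_left_pos[OF pi_gt_zero])
  then show ?thesis by (simp add: abs_le_iff field_simps)
qed

text \<open>
  The jump at \<open>\<beta>\<close> differs from the one at \<open>\<alpha>\<close> in that the reflected arc starts at distance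
  \<open>2 \<beta>\<close>, which can be smaller than \<open>\<alpha> - \<beta>\<close> and must be bounded separately.
\<close>

lemma jackson_window_at_lower_jump:
  assumes "D \<le> \<alpha> - \<beta>" "D \<le> 2 * \<beta>"
  shows "\<bar>jackson_window d \<alpha> \<beta> \<beta> - 1 / 2\<bar> \<le> \<epsilon> / 2"
proof -
  let ?F = "jackson_primitive d"
  have "pi - pi * \<epsilon> \<le> ?F (\<alpha> - \<beta>)" "pi - pi * \<epsilon> \<le> ?F (\<beta> + \<beta>)"
    using assms by (auto intro!: jackson_primitive_beyond)
  moreover have "?F (\<beta> + \<beta>) \<le> ?F (\<alpha> + \<beta>)" using \<beta>\<alpha> by (auto intro!: jackson_primitive_mono)
  moreover have "?F (\<alpha> + \<beta>) \<le> pi" "?F (\<alpha> - \<beta>) \<le> pi"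
    using \<alpha> \<beta>\<alpha> \<beta> by (auto intro!: jackson_primitive_before_pi)
  ultimately have "pi - pi * \<epsilon> \<le> ?F (\<alpha> + \<beta>) + ?F (\<alpha> - \<beta>) - ?F (\<beta> + \<beta>) - ?F (\<beta> - \<beta>)"
    "?F (\<alpha> + \<beta>) + ?F (\<alpha> - \<beta>) - ?F (\<beta> + \<beta>) - ?F (\<beta> - \<beta>) \<le> pi + pi * \<epsilon>"
    by (simp_all add: jackson_primitive_0)
  moreover have "?F (\<alpha> + \<beta>) + ?F (\<alpha> - \<beta>) - ?F (\<beta> + \<beta>) - ?F (\<beta> - \<beta>) = 2 * pi * jackson_window d \<alpha> \<beta> \<beta>"
    by (simp add: jackson_window_def)
  ultimately have "pi * (1 - \<epsilon>) \<le> pi * (2 * jackson_window d \<alpha> \<beta> \<beta>)"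
    "pi * (2 * jackson_window d \<alpha> \<beta> \<beta>) \<le> pi * (1 + \<epsilon>)" by (simp_all add: algebra_simps)
  then have "1 - \<epsilon> \<le> 2 * jackson_window d \<alpha> \<beta> \<beta>" "2 * jackson_window d \<alpha> \<beta> \<beta> \<le> 1 + \<epsilon>"
    by (simp_all only: mult_le_cancel_left_pos[OF pi_gt_zero])
  then show ?thesis by (simp add: abs_le_iff field_simps)
qed

end

end

section \<open>Orthonormal eigenvectors\<close>

lemma sum_UNIV_Plus:
  "(\<Sum>k\<in>(UNIV :: ('a::finite + 'b::finite) set). f k)
    = (\<Sum>i\<in>UNIV. f (Inl i)) + (\<Sum>j\<in>UNIV. f (Inr j))"
  by (simp add: UNIV_Plus_UNIV[symmetric] sum.Plus del: UNIV_Plus_UNIV)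

lemma sum_matrix_vector_mult: "(\<Sum>i\<in>I. F i) *v x = (\<Sum>i\<in>I. F i *v x)"
  for F :: "'i \<Rightarrow> real^'n^'m"
  by (induction I rule: infinite_finite_induct) (simp_all add: matrix_vector_mult_add_rdistrib)

lemma orthogonal_matrix_iff_sum:
  fixes Q :: "real^'k^'k"
  shows "orthogonal_matrix Q \<longleftrightarrow>
    (\<forall>k l. (\<Sum>p\<in>UNIV. Q $ p $ k * Q $ p $ l) = (if k = l then 1 else 0))"
  by (simp add: orthogonal_matrix vec_eq_iff matrix_matrix_mult_def transpose_def mat_def)

lemma orthogonal_matrix_norm_mult:
  fixes Q :: "real^'k^'k"
  assumes "orthogonal_matrix Q"
  shows "norm (Q *v x) = norm x"
proof -
  have "orthogonal_transformation ((*v) Q)"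
    using assms by (simp add: orthogonal_transformation_matrix)
  then show ?thesis by (rule orthogonal_transformation_norm)
qed

text \<open>
  In the coordinates \<open>y = Q\<^sup>T x\<close> the matrix acts componentwise, and passing to \<open>y\<close> preserves norms.
\<close>

lemma norm2_le_of_orthonormal_eigenvectors:
  fixes M Q :: "real^'k^'k"
  assumes Q: "orthogonal_matrix Q"
    and eig: "\<And>k. M *v column k Q = \<mu> k *\<^sub>R column k Q"
    and bound: "\<And>k. \<bar>\<mu> k\<bar> \<le> \<epsilon>"
  shows "norm2 M \<le> \<epsilon>"
  unfolding norm2_def
proof (rule onorm_bound)
  show "0 \<le> \<epsilon>" using bound[of undefined] by linarith
  fix x
  define y where "y = transpose Q *v x"
  have x: "x = Q *v y"
    using Q unfolding y_def matrix_vector_mul_assoc orthogonal_matrix_def by simp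
  have "M *v x = (\<Sum>k\<in>UNIV. y $ k *\<^sub>R (M *v column k Q))"
    by (simp add: x matrix_mult_sum[of Q] scalar_mult_eq_scaleR linear_sum[OF matrix_vector_mul_linear]
        matrix_vector_mult_scaleR)
  also have "\<dots> = Q *v (\<chi> k. \<mu> k * y $ k)"
    by (simp add: matrix_mult_sum[of Q] eig scalar_mult_eq_scaleR mult.commute)
  finally have "norm (M *v x) = norm (\<chi> k. \<mu> k * y $ k)"
    using Q by (simp add: orthogonal_matrix_norm_mult)
  also have "\<dots> \<le> norm (\<epsilon> *\<^sub>R y)"
    by (rule norm_le_componentwise_cart)
      (use bound \<open>0 \<le> \<epsilon>\<close> in \<open>auto simp: abs_mult intro!: mult_right_mono\<close>)
  also have "\<dots> = \<epsilon> * norm x"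
    using Q \<open>0 \<le> \<epsilon>\<close> by (simp add: x orthogonal_matrix_norm_mult)
  finally show "norm (M *v x) \<le> \<epsilon> * norm x" .
qed

lemma mat_pow_eigenvector:
  assumes "M *v v = c *\<^sub>R v"
  shows "mat_pow M k *v v = c ^ k *\<^sub>R v"
  by (induction k)
    (simp_all add: matrix_vector_mul_assoc[symmetric] matrix_vector_mult_scaleR assms mult.commute)

lemma poly_mat_eigenvector:
  assumes "M *v v = c *\<^sub>R v"
  shows "poly_mat p M *v v = poly p c *\<^sub>R v"
  by (simp add: poly_mat_def sum_matrix_vector_mult scaleR_matrix_vector_assoc[symmetric]
      mat_pow_eigenvector[OF assms] poly_altdef scaleR_sum_left)

lemma cj_mat_eigenvector:
  assumes "augmented A *v v = c *\<^sub>R v"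
  shows "cj_mat A a b d *v v = cj_fun A a b d (lscale A c) *\<^sub>R v"
proof -
  have "((1 / norm2 A) *\<^sub>R augmented A) *v v = lscale A c *\<^sub>R v"
    by (simp add: scaleR_matrix_vector_assoc[symmetric] assms lscale_def)
  from poly_mat_eigenvector[OF this] show ?thesis
    by (simp add: cj_mat_def cj_fun_def sum_matrix_vector_mult scaleR_matrix_vector_assoc[symmetric]
        scaleR_sum_left)
qed

lemma col_gram_column:
  fixes Q :: "real^'k^'k"
  assumes "orthogonal_matrix Q"
  shows "col_gram Q K *v column k Q = (if k \<in> K then 1 else 0) *\<^sub>R column k Q"
proof -
  have o: "(\<Sum>q\<in>UNIV. Q $ q $ l * Q $ q $ k) = (if l = k then 1 else 0)" for l
    using assms by (simp add: orthogonal_matrix_iff_sum)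
  have "(\<Sum>q\<in>UNIV. (\<Sum>l\<in>K. Q $ p $ l * Q $ q $ l) * Q $ q $ k)
      = (if k \<in> K then Q $ p $ k else 0)" for p
  proof -
    have "(\<Sum>q\<in>UNIV. (\<Sum>l\<in>K. Q $ p $ l * Q $ q $ l) * Q $ q $ k)
        = (\<Sum>l\<in>K. Q $ p $ l * (\<Sum>q\<in>UNIV. Q $ q $ l * Q $ q $ k))"
      unfolding sum_distrib_left sum_distrib_right by (subst sum.swap) (simp add: mult.assoc)
    then show ?thesis by (simp add: o if_distrib sum.delta cong: if_cong)
  qed
  then show ?thesis
    by (simp add: vec_eq_iff matrix_vector_mult_def col_gram_def column_def)
qed

lemma Qmat_entries:
  assumes "inj \<iota>"
  shows "Qmat U \<iota> V $ Inl i $ Inl j = V $ i $ j / sqrt 2"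
    "Qmat U \<iota> V $ Inr r $ Inl j = U $ r $ \<iota> j / sqrt 2"
    "Qmat U \<iota> V $ Inl i $ Inr (\<iota> j) = V $ i $ j / sqrt 2"
    "Qmat U \<iota> V $ Inr r $ Inr (\<iota> j) = - U $ r $ \<iota> j / sqrt 2"
    "l \<notin> range \<iota> \<Longrightarrow> Qmat U \<iota> V $ Inl i $ Inr l = 0"
    "l \<notin> range \<iota> \<Longrightarrow> Qmat U \<iota> V $ Inr r $ Inr l = U $ r $ l"
  using assms by (auto simp: Qmat_def)

lemma Qeig_entries:
  assumes "inj \<iota>"
  shows "Qeig \<iota> s $ Inl j = s $ j" "Qeig \<iota> s $ Inr (\<iota> j) = - s $ j"
    "l \<notin> range \<iota> \<Longrightarrow> Qeig \<iota> s $ Inr l = 0"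
  using assms by (auto simp: Qeig_def)

text \<open>
  The three kinds of columns of \<open>Qmat U \<iota> V\<close>: those for a singular value, for its negative, and for one
  of the additional zero eigenvalues.
\<close>

lemma block_index_cases:
  fixes k :: "'n + 'm" and \<iota> :: "'n \<Rightarrow> 'm"
  obtains (pos) j where "k = Inl j"
    | (neg) j where "k = Inr (\<iota> j)"
    | (zero) l where "k = Inr l" "l \<notin> range \<iota>"
  by (cases k) auto

lemma orthogonal_matrix_Qmat:
  assumes inj: "inj \<iota>" and U: "orthogonal_matrix U" and V: "orthogonal_matrix V"
  shows "orthogonal_matrix (Qmat U \<iota> V)"
  unfolding orthogonal_matrix_iff_sum
proof (intro allI)
  fix k l
  have u: "(\<Sum>r\<in>UNIV. U $ r $ i * U $ r $ j) = (if i = j then 1 else 0)" for i j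
    using U by (simp add: orthogonal_matrix_iff_sum)
  have v: "(\<Sum>r\<in>UNIV. V $ r $ i * V $ r $ j) = (if i = j then 1 else 0)" for i j
    using V by (simp add: orthogonal_matrix_iff_sum)
  have neq: "\<iota> j \<noteq> l" "l \<noteq> \<iota> j" if "l \<notin> range \<iota>" for j l
    using that by auto
  show "(\<Sum>p\<in>UNIV. Qmat U \<iota> V $ p $ k * Qmat U \<iota> V $ p $ l) = (if k = l then 1 else 0)"
    by (cases k rule: block_index_cases[where \<iota> = \<iota>]; cases l rule: block_index_cases[where \<iota> = \<iota>])
      (auto simp: sum_UNIV_Plus Qmat_entries[OF inj] sum_divide_distrib[symmetric] sum_negf u v
        inj_eq[OF inj] neq)
qed

text \<open>
  Entrywise forms of \<open>A v\<^sub>j = s\<^sub>j u\<^sub>j\<close>, \<open>A\<^sup>T u\<^sub>j = s\<^sub>j v\<^sub>j\<close> and \<open>A\<^sup>T u = 0\<close> for the remaining columns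
  \<open>u\<close> of \<open>U\<close>; these are what the blocks of the augmented matrix act by.
\<close>

lemma is_svd_sums:
  assumes "is_svd A U \<iota> s V"
  shows svd_mult_right: "(\<Sum>i\<in>UNIV. A $ r $ i * V $ i $ j) = s $ j * U $ r $ \<iota> j"
    and svd_mult_left: "(\<Sum>r\<in>UNIV. A $ r $ i * U $ r $ \<iota> j) = s $ j * V $ i $ j"
    and svd_mult_left_kernel: "l \<notin> range \<iota> \<Longrightarrow> (\<Sum>r\<in>UNIV. A $ r $ i * U $ r $ l) = 0"
proof -
  have inj: "inj \<iota>" and U: "orthogonal_matrix U" and V: "orthogonal_matrix V"
    and A: "A = U ** rect_diag \<iota> s ** transpose V"
    using assms by (auto simp: is_svd_def)
  have u: "(\<Sum>r\<in>UNIV. U $ r $ i * U $ r $ j) = (if i = j then 1 else 0)" for i j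
    using U by (simp add: orthogonal_matrix_iff_sum)
  have v: "(\<Sum>r\<in>UNIV. V $ r $ i * V $ r $ j) = (if i = j then 1 else 0)" for i j
    using V by (simp add: orthogonal_matrix_iff_sum)
  have entry: "A $ r $ i = (\<Sum>j\<in>UNIV. s $ j * U $ r $ \<iota> j * V $ i $ j)" for r i
    by (simp add: A matrix_matrix_mult_def rect_diag_def transpose_def if_distrib sum.delta mult.commute
        cong: if_cong)
  have left: "(\<Sum>r\<in>UNIV. A $ r $ i * U $ r $ l)
      = (\<Sum>j\<in>UNIV. s $ j * V $ i $ j * (if \<iota> j = l then 1 else 0))" for i l
    unfolding entry sum_distrib_right u[symmetric] sum_distrib_left
    by (subst sum.swap) (simp add: mult_ac)
  show "(\<Sum>r\<in>UNIV. A $ r $ i * U $ r $ \<iota> j) = s $ j * V $ i $ j"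
    unfolding left inj_eq[OF inj] by (simp add: if_distrib sum.delta cong: if_cong)
  show "(\<Sum>r\<in>UNIV. A $ r $ i * U $ r $ l) = 0" if "l \<notin> range \<iota>"
    unfolding left using that by (intro sum.neutral) auto
  have "(\<Sum>i\<in>UNIV. A $ r $ i * V $ i $ j)
      = (\<Sum>k\<in>UNIV. s $ k * U $ r $ \<iota> k * (if k = j then 1 else 0))"
    unfolding entry sum_distrib_right v[symmetric] sum_distrib_left
    by (subst sum.swap) (simp add: mult_ac)
  then show "(\<Sum>i\<in>UNIV. A $ r $ i * V $ i $ j) = s $ j * U $ r $ \<iota> j"
    by (simp add: if_distrib sum.delta cong: if_cong)
qed

lemma augmented_eigenvector:
  assumes svd: "is_svd A U \<iota> s V"
  shows "augmented A *v column k (Qmat U \<iota> V) = Qeig \<iota> s $ k *\<^sub>R column k (Qmat U \<iota> V)"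
proof -
  have inj: "inj \<iota>" using svd by (simp add: is_svd_def)
  have "(augmented A *v column k (Qmat U \<iota> V)) $ p = (Qeig \<iota> s $ k *\<^sub>R column k (Qmat U \<iota> V)) $ p" for p
    by (cases p; cases k rule: block_index_cases[where \<iota> = \<iota>])
      (simp_all add: matrix_vector_mult_def sum_UNIV_Plus augmented_def column_def transpose_def
        Qmat_entries[OF inj] Qeig_entries[OF inj] sum_divide_distrib[symmetric] sum_negf
        svd_mult_right[OF svd] svd_mult_left[OF svd] svd_mult_left_kernel[OF svd])
  then show ?thesis by (simp add: vec_eq_iff)
qed

text \<open>
  A right singular vector is a unit vector that \<open>A\<close> stretches by the singular value. The bound places
  the scaled spectrum in \<open>[-1, 1]\<close>, the range of the substitution \<open>x = cos \<theta>\<close>.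
\<close>

lemma singular_value_le_norm2:
  assumes svd: "is_svd A U \<iota> s V"
  shows "s $ j \<le> norm2 A"
proof -
  have U: "orthogonal_matrix U" and V: "orthogonal_matrix V" and s: "0 \<le> s $ j"
    using svd by (auto simp: is_svd_def)
  have n: "norm (column i X) = 1" if "orthogonal_matrix X" for X :: "real^'k^'k" and i
    using that by (simp add: orthogonal_matrix_orthonormal_columns)
  have "A *v column j V = s $ j *\<^sub>R column (\<iota> j) U"
    by (simp add: vec_eq_iff matrix_vector_mult_def column_def svd_mult_right[OF svd])
  then have "s $ j = norm (A *v column j V)" using s n[OF U] by simp
  also have "\<dots> \<le> norm2 A * norm (column j V)"
    unfolding norm2_def by (rule onorm) simp
  finally show ?thesis by (simp add: n[OF V])
qed

definition step_weight :: "real \<Rightarrow> real \<Rightarrow> real \<Rightarrow> real" where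
  "step_weight a b x = (if a < x \<and> x < b then 1 else if x = a \<or> x = b then 1 / 2 else 0)"

lemma spectral_projector_eigenvector:
  assumes svd: "is_svd A U \<iota> s V" and ab: "a < b"
  shows "spectral_projector U \<iota> s V a b *v column k (Qmat U \<iota> V)
    = step_weight a b (Qeig \<iota> s $ k) *\<^sub>R column k (Qmat U \<iota> V)"
proof -
  have Q: "orthogonal_matrix (Qmat U \<iota> V)"
    using svd by (simp add: is_svd_def orthogonal_matrix_Qmat)
  show ?thesis
    using ab by (auto simp: spectral_projector_def matrix_vector_mult_add_rdistrib
        scaleR_matrix_vector_assoc[symmetric] col_gram_column[OF Q] step_weight_def)
qed

section \<open>The pointwise error at the eigenvalues\<close>

lemma cheb_poly_cos: "poly (cheb_poly j) (cos \<theta>) = cos (real j * \<theta>)"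
proof (induction j rule: cheb_poly.induct)
  case (3 j)
  have e1: "real (Suc (Suc j)) * \<theta> = real (Suc j) * \<theta> + \<theta>"
    and e2: "real j * \<theta> = real (Suc j) * \<theta> - \<theta>"
    by (simp_all add: algebra_simps)
  have "cos (real (Suc (Suc j)) * \<theta>) = 2 * cos \<theta> * cos (real (Suc j) * \<theta>) - cos (real j * \<theta>)"
    unfolding e1 e2 cos_add cos_diff by simp
  then show ?case using 3 by simp
qed auto

text \<open>
  The coefficients \<open>c\<^sub>j\<close> are the Fourier coefficients of the indicator function, and
  \<open>2 sin (j c) cos (j \<theta>) = sin (j (c + \<theta>)) + sin (j (c - \<theta>))\<close> turns the sum into values of the
  primitive of the kernel.
\<close>

lemma cj_fun_cos_eq_jackson_window:
  fixes A :: "real^'n^'m"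
  shows "cj_fun A a b d (cos \<theta>)
    = jackson_window d (arccos (lscale A a)) (arccos (lscale A b)) \<theta>"
proof -
  define \<alpha> where "\<alpha> c = arccos (lscale A c)" for c
  define T where "T c j = jackson j d * sin (real j * (c + \<theta>)) / real j
      + jackson j d * sin (real j * (c - \<theta>)) / real j" for c j
  have prod: "T c j = 2 * jackson j d * sin (real j * c) / real j * cos (real j * \<theta>)" for c j
    by (simp add: T_def distrib_left right_diff_distrib sin_add sin_diff add_divide_distrib[symmetric])
  have pair: "jackson_primitive d (c + \<theta>) + jackson_primitive d (c - \<theta>)
      = 2 * c + 2 * (\<Sum>j=1..d. T c j)" for c
    by (simp add: jackson_primitive_def T_def sum.distrib)
  have "cj_fun A a b d (cos \<theta>)
     = cheb_coeff A a b 0 + (\<Sum>j=1..d. jackson j d * cheb_coeff A a b j * cos (real j * \<theta>))"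
    unfolding cj_fun_def cheb_poly_cos
    by (simp add: sum.atLeast_Suc_atMost jackson_0)
  also have "(\<Sum>j=1..d. jackson j d * cheb_coeff A a b j * cos (real j * \<theta>))
      = (\<Sum>j=1..d. 1 / pi * (T (\<alpha> a) j - T (\<alpha> b) j))"
    unfolding prod
    by (rule sum.cong) (auto simp: cheb_coeff_def \<alpha>_def field_simps)
  also have "\<dots> = 1 / pi * ((\<Sum>j=1..d. T (\<alpha> a) j) - (\<Sum>j=1..d. T (\<alpha> b) j))"
    by (simp only: sum_distrib_left[symmetric] sum_subtractf)
  also have "cheb_coeff A a b 0 + \<dots>
      = ((2 * \<alpha> a + 2 * (\<Sum>j=1..d. T (\<alpha> a) j)) - (2 * \<alpha> b + 2 * (\<Sum>j=1..d. T (\<alpha> b) j))) / (2 * pi)"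
    by (simp add: cheb_coeff_def \<alpha>_def field_simps)
  finally show ?thesis
    unfolding pair[symmetric] jackson_window_def \<alpha>_def by (simp add: algebra_simps)
qed

lemma arccos_lscale_window:
  assumes ab: "0 < a" "a < b" "b \<le> norm2 A"
  shows "0 \<le> arccos (lscale A b)" "arccos (lscale A b) < arccos (lscale A a)"
    "arccos (lscale A a) \<le> pi / 2"
proof -
  have l: "0 < lscale A a" "lscale A a < lscale A b" "lscale A b \<le> 1"
    using ab by (auto simp: lscale_def divide_strict_right_mono)
  then show "0 \<le> arccos (lscale A b)" by (intro arccos_lbound) auto
  show "arccos (lscale A b) < arccos (lscale A a)" using l by (intro arccos_less_arccos) auto
  show "arccos (lscale A a) \<le> pi / 2" using l by (intro arccos_le_pi2) auto
qed

lemma cj_fun_range: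
  fixes A :: "real^'n^'m"
  assumes ab: "0 < a" "a < b" "b \<le> norm2 A" and x: "\<bar>x\<bar> \<le> norm2 A"
  shows "0 \<le> cj_fun A a b d (lscale A x)" "cj_fun A a b d (lscale A x) \<le> 1"
proof -
  have l: "\<bar>lscale A x\<bar> \<le> 1" using ab x by (simp add: lscale_def)
  note window = jackson_window_nonneg[OF arccos_lscale_window[OF ab]]
    jackson_window_le_1[OF arccos_lscale_window[OF ab]]
  have "cj_fun A a b d (lscale A x) = jackson_window d (arccos (lscale A a)) (arccos (lscale A b)) (arccos (lscale A x))"
    using cj_fun_cos_eq_jackson_window[of A a b d "arccos (lscale A x)"] l by (simp add: cos_arccos_abs)
  then show "0 \<le> cj_fun A a b d (lscale A x)" "cj_fun A a b d (lscale A x) \<le> 1"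
    using window l by (auto simp: arccos_lbound arccos_ubound abs_le_iff)
qed

text \<open>
  The hypotheses say that the angle of \<open>x\<close> keeps distance \<open>D\<close> from both jumps, unless \<open>x\<close> is itself a
  jump. In that case the arc must have length at least \<open>D\<close>, and \<open>D \<le> \<theta> b\<close> keeps its mirror image
  away from \<open>\<theta> b\<close>.
\<close>

lemma cj_fun_step_error:
  fixes A :: "real^'n^'m" and D :: real
  defines "\<theta> \<equiv> \<lambda>x. arccos (lscale A x)"
  assumes ab: "0 < a" "a < b" "b \<le> norm2 A" and x: "\<bar>x\<bar> \<le> norm2 A"
    and D: "0 < D" "D \<le> \<theta> a - \<theta> b" "D \<le> \<theta> b"
    and below: "x < a \<Longrightarrow> D \<le> \<theta> x - \<theta> a"
    and inside: "a < x \<Longrightarrow> x < b \<Longrightarrow> D \<le> \<theta> a - \<theta> x \<and> D \<le> \<theta> x - \<theta> b"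
    and above: "b < x \<Longrightarrow> D \<le> \<theta> b - \<theta> x"
  shows "\<bar>step_weight a b x - cj_fun A a b d (lscale A x)\<bar>
    \<le> pi ^ 6 / (2 * (real d + 2) ^ 3 * D ^ 4)"
proof -
  define \<epsilon> where "\<epsilon> = pi ^ 6 / (2 * (real d + 2) ^ 3 * D ^ 4)"
  have \<epsilon>: "0 \<le> \<epsilon>" by (simp add: \<epsilon>_def)
  have l: "\<bar>lscale A x\<bar> \<le> 1" using ab x by (simp add: lscale_def)
  then have \<theta>: "0 \<le> \<theta> x" "\<theta> x \<le> pi" by (auto simp: \<theta>_def arccos_lbound arccos_ubound abs_le_iff)
  have w: "0 \<le> \<theta> b" "\<theta> b < \<theta> a" "\<theta> a \<le> pi / 2"
    unfolding \<theta>_def by (rule arccos_lscale_window[OF ab])+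
  have eq: "cj_fun A a b d (lscale A x) = jackson_window d (\<theta> a) (\<theta> b) (\<theta> x)"
    using cj_fun_cos_eq_jackson_window[of A a b d "\<theta> x"] l by (simp add: \<theta>_def cos_arccos_abs)
  have "pi - jackson_primitive d D \<le> pi * \<epsilon>"
    unfolding \<epsilon>_def using D w by (intro jackson_primitive_tail) auto
  note est = jackson_window_inside[OF w _ this] jackson_window_above[OF w _ this]
    jackson_window_below[OF w _ this] jackson_window_at_upper_jump[OF w _ this]
    jackson_window_at_lower_jump[OF w _ this]
  note range = cj_fun_range[OF ab x, of d, unfolded eq]
  consider "x < a" | "x = a" | "a < x" "x < b" | "x = b" | "b < x" by linarith
  then show ?thesis
    unfolding \<epsilon>_def[symmetric] eq
  proof cases
    case 1
    then show "\<bar>step_weight a b x - jackson_window d (\<theta> a) (\<theta> b) (\<theta> x)\<bar> \<le> \<epsilon>"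
      using est(2)[of "\<theta> x"] below \<theta> range D ab by (simp add: step_weight_def)
  next
    case 2
    then show "\<bar>step_weight a b x - jackson_window d (\<theta> a) (\<theta> b) (\<theta> x)\<bar> \<le> \<epsilon>"
      using est(4) D \<epsilon> ab by (simp add: step_weight_def abs_minus_commute[of "1 / 2"])
  next
    case 3
    then show "\<bar>step_weight a b x - jackson_window d (\<theta> a) (\<theta> b) (\<theta> x)\<bar> \<le> \<epsilon>"
      using est(1)[of "\<theta> x"] inside range D by (simp add: step_weight_def)
  next
    case 4
    then show "\<bar>step_weight a b x - jackson_window d (\<theta> a) (\<theta> b) (\<theta> x)\<bar> \<le> \<epsilon>"
      using est(5) D \<epsilon> ab by (simp add: step_weight_def abs_minus_commute[of "1 / 2"])
  next
    case 5
    then show "\<bar>step_weight a b x - jackson_window d (\<theta> a) (\<theta> b) (\<theta> x)\<bar> \<le> \<epsilon>"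
      using est(3)[of "\<theta> x"] above \<theta> range D ab by (simp add: step_weight_def)
  qed
qed

lemma error_bound_less_quarter:
  fixes D :: real
  assumes D: "0 < D" and d: "real d > root 3 2 * pi\<^sup>2 / D powr (4 / 3) - 2"
  shows "pi ^ 6 / (2 * (real d + 2) ^ 3 * D ^ 4) < 1 / 4"
proof -
  have "(D powr (4 / 3)) ^ 3 = (D powr (4 / 3)) powr real 3"
    using D by (intro powr_realpow[symmetric]) simp
  also have "\<dots> = D powr real 4" by (simp only: powr_powr) simp
  also have "\<dots> = D ^ 4" by (rule powr_realpow[OF D])
  finally have D4: "(D powr (4 / 3)) ^ 3 = D ^ 4" .
  have "(root 3 2 * pi\<^sup>2 / D powr (4 / 3)) ^ 3 < (real d + 2) ^ 3"
    using d D by (intro power_strict_mono) auto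
  then have "2 * pi ^ 6 / D ^ 4 < (real d + 2) ^ 3"
    by (simp add: power_divide power_mult_distrib D4 flip: power_mult)
  then have "2 * pi ^ 6 < (real d + 2) ^ 3 * D ^ 4" using D by (simp add: pos_divide_less_eq)
  then show ?thesis using D by (simp add: pos_divide_less_eq mult.commute)
qed

section \<open>Separation of the eigenvalues\<close>

text \<open>
  The function \<open>g\<close> is within \<open>1/4\<close> of the step function on the spectrum. An eigenvalue outside the first
  \<open>nsv\<close> comes from a singular value outside \<open>[a, b]\<close>, from a negated singular value or from a zero; the
  latter two are nonpositive. In all cases the step function vanishes there. The three groups of values
  thus lie in \<open>(3/4, 1]\<close>, \<open>(1/4, 3/4)\<close> and \<open>[0, 1/4)\<close>, and sorting each group sorts all values.
\<close>

lemma sorted_eigenvalues_chain: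
  fixes \<sigma> \<gamma> :: "nat \<Rightarrow> real" and S :: "real set" and g :: "real \<Rightarrow> real"
  assumes \<sigma>: "\<sigma> ` {1..n} = S" and r: "r \<le> nsv" "nsv \<le> n"
    and inner: "\<forall>i\<in>{1..n}. \<sigma> i \<in> {a..b} \<longleftrightarrow> i \<le> nsv" "\<forall>i\<in>{1..r}. \<sigma> i \<in> {a<..<b}"
      "\<forall>i\<in>{r+1..nsv}. \<sigma> i \<in> {a, b}"
    and \<L>: "\<L> = image_mset \<sigma> (mset_set {1..n}) + image_mset (\<lambda>i. - \<sigma> i) (mset_set {1..n})
               + replicate_mset z 0"
    and \<gamma>: "\<forall>i\<in>{1..nsv}. \<gamma> i = g (\<sigma> i)" "antimono_on {1..r} \<gamma>" "antimono_on {r+1..nsv} \<gamma>"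
      "image_mset \<gamma> (mset_set {nsv+1..N}) = image_mset g (\<L> - image_mset \<sigma> (mset_set {1..nsv}))"
      "antimono_on {nsv+1..N} \<gamma>"
    and S: "\<And>x. x \<in> S \<Longrightarrow> 0 \<le> x" and ab: "0 < a" "a < b"
    and g: "\<And>x. x \<in> S \<or> - x \<in> S \<or> x = 0 \<Longrightarrow> 0 \<le> g x \<and> g x \<le> 1 \<and> \<bar>step_weight a b x - g x\<bar> < 1 / 4"
  shows "antimono_on {1..N} \<gamma>
     \<and> (\<forall>i\<in>{1..r}. 1 \<ge> \<gamma> i \<and> \<gamma> i > 3 / 4)
     \<and> (\<forall>i\<in>{r+1..nsv}. 3 / 4 > \<gamma> i \<and> \<gamma> i > 1 / 4)
     \<and> (\<forall>i\<in>{nsv+1..N}. 1 / 4 > \<gamma> i \<and> \<gamma> i \<ge> 0)"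
proof -
  have A: "\<gamma> i \<le> 1 \<and> 3 / 4 < \<gamma> i" if "i \<in> {1..r}" for i
  proof -
    have "\<sigma> i \<in> S" "i \<in> {1..nsv}" using that r \<sigma> by auto
    then show ?thesis
      using g[of "\<sigma> i"] inner(2) \<gamma>(1) that by (auto simp: step_weight_def abs_less_iff)
  qed
  have B: "\<gamma> i < 3 / 4 \<and> 1 / 4 < \<gamma> i" if "i \<in> {r+1..nsv}" for i
  proof -
    have s: "\<sigma> i \<in> S" "i \<in> {1..nsv}" using that r \<sigma> by auto
    have "step_weight a b (\<sigma> i) = 1 / 2"
      unfolding step_weight_def using inner(3) that ab by auto
    moreover have "\<bar>step_weight a b (\<sigma> i) - \<gamma> i\<bar> < 1 / 4" using g[of "\<sigma> i"] s \<gamma>(1) by simp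
    ultimately show ?thesis by (simp only: abs_less_iff) linarith
  qed
  have split: "image_mset \<sigma> (mset_set {1..n})
      = image_mset \<sigma> (mset_set {1..nsv}) + image_mset \<sigma> (mset_set {nsv+1..n})"
  proof -
    have "{1..n} = {1..nsv} \<union> {nsv+1..n}" using r by auto
    then have "mset_set {1..n} = mset_set ({1..nsv} \<union> {nsv+1..n})" by (rule arg_cong)
    also have "\<dots> = mset_set {1..nsv} + mset_set {nsv+1..n}" by (rule mset_set_Union) auto
    finally show ?thesis by (simp only: image_mset_union)
  qed
  have C: "\<gamma> i < 1 / 4 \<and> 0 \<le> \<gamma> i" if "i \<in> {nsv+1..N}" for i
  proof -
    have "\<gamma> i \<in># image_mset \<gamma> (mset_set {nsv+1..N})" using that by auto
    then obtain x where x: "x \<in># \<L> - image_mset \<sigma> (mset_set {1..nsv})" and gx: "\<gamma> i = g x"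
      unfolding \<gamma>(4) by auto
    from x have "x \<in> \<sigma> ` {nsv+1..n} \<or> - x \<in> S \<or> x = 0"
      unfolding \<L> split \<sigma>[symmetric] by (auto split: if_splits)
    then consider k where "k \<in> {nsv+1..n}" "x = \<sigma> k" | "- x \<in> S" | "x = 0" by blast
    then have "(x \<in> S \<or> - x \<in> S \<or> x = 0) \<and> x \<notin> {a..b}"
    proof cases
      case 1
      then have "k \<in> {1..n}" "\<not> k \<le> nsv" by auto
      then show ?thesis using inner(1) \<sigma> 1(2) by blast
    next
      case 2
      then show ?thesis using S[of "- x"] ab by simp
    next
      case 3
      then show ?thesis using ab by simp
    qed
    then show ?thesis using g[of x] ab by (auto simp: gx step_weight_def)
  qed
  have "antimono_on {1..N} \<gamma>"
  proof (rule monotone_onI)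
    fix i j assume ij: "i \<in> {1..N}" "j \<in> {1..N}" "i \<le> j"
    consider "j \<le> r" | "r < i" "j \<le> nsv" | "nsv < i" | "i \<le> r" "r < j" "j \<le> nsv" | "i \<le> r" "nsv < j"
      | "r < i" "i \<le> nsv" "nsv < j" by linarith
    then show "\<gamma> j \<le> \<gamma> i"
    proof cases
      case 1 then show ?thesis using monotone_onD[OF \<gamma>(2), of i j] ij by simp
    next
      case 2 then show ?thesis using monotone_onD[OF \<gamma>(3), of i j] ij by simp
    next
      case 3 then show ?thesis using monotone_onD[OF \<gamma>(5), of i j] ij by simp
    next
      case 4 then show ?thesis using A[of i] B[of j] ij by simp
    next
      case 5 then show ?thesis using A[of i] C[of j] ij by simp
    next
      case 6 then show ?thesis using B[of i] C[of j] ij by simp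
    qed
  qed
  then show ?thesis using A B C by blast
qed

theorem theorem5p1:
  fixes A :: "real^'n^'m" and U :: "real^'m^'m" and V :: "real^'n^'n"
    and \<iota> :: "'n \<Rightarrow> 'm" and s :: "real^'n" and a b :: real and d :: nat
    and \<sigma>il \<sigma>ir \<sigma>ol \<sigma>or \<alpha> \<beta> \<Delta>il \<Delta>ir \<Delta>ol \<Delta>or \<Delta>min :: real
  assumes mn: "CARD('n) \<le> CARD('m)"
    and svd: "is_svd A U \<iota> s V"
    and ab: "0 < a" "a < b" "{a..b} \<subseteq> {Min (range (($) s)) .. norm2 A}"
    and il: "is_arg_min (\<lambda>x. \<bar>x - a\<bar>) (\<lambda>x. x \<in> range (($) s) \<and> a < x \<and> x < b) \<sigma>il"
    and ir: "is_arg_min (\<lambda>x. \<bar>x - b\<bar>) (\<lambda>x. x \<in> range (($) s) \<and> a < x \<and> x < b) \<sigma>ir"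
    and ol: "is_arg_min (\<lambda>x. \<bar>x - a\<bar>) (\<lambda>x. x \<in> range (($) s) \<and> x < a) \<sigma>ol"
    and or: "is_arg_min (\<lambda>x. \<bar>x - b\<bar>) (\<lambda>x. x \<in> range (($) s) \<and> b < x) \<sigma>or"
    and \<alpha>: "\<alpha> = arccos (lscale A a)" and \<beta>: "\<beta> = arccos (lscale A b)"
    and \<Delta>il: "\<Delta>il = \<bar>arccos (lscale A \<sigma>il) - \<alpha>\<bar>"
    and \<Delta>ir: "\<Delta>ir = \<bar>arccos (lscale A \<sigma>ir) - \<beta>\<bar>"
    and \<Delta>ol: "\<Delta>ol = \<bar>arccos (lscale A \<sigma>ol) - \<alpha>\<bar>"
    and \<Delta>or: "\<Delta>or = \<bar>arccos (lscale A \<sigma>or) - \<beta>\<bar>"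
    and \<Delta>min: "\<Delta>min = Min {\<Delta>il, \<Delta>ir, \<Delta>ol, \<Delta>or}"
  shows "norm2 (spectral_projector U \<iota> s V a b - cj_mat A a b d)
           \<le> pi ^ 6 / (2 * (real d + 2) ^ 3 * \<Delta>min ^ 4)
    \<and> (real d > root 3 2 * pi\<^sup>2 / \<Delta>min powr (4 / 3) - 2 \<longrightarrow>
        norm2 (spectral_projector U \<iota> s V a b - cj_mat A a b d) < 1 / 4
        \<and> (\<forall>(\<sigma> :: nat \<Rightarrow> real) (\<gamma> :: nat \<Rightarrow> real) (r :: nat) (nsv :: nat) (\<L> :: real multiset).
             image_mset \<sigma> (mset_set {1..CARD('n)}) = image_mset (($) s) (mset_set UNIV)
             \<and> r \<le> nsv \<and> nsv \<le> CARD('n)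
             \<and> (\<forall>i\<in>{1..CARD('n)}. \<sigma> i \<in> {a..b} \<longleftrightarrow> i \<le> nsv)
             \<and> (\<forall>i\<in>{1..r}. \<sigma> i \<in> {a<..<b})
             \<and> (\<forall>i\<in>{r+1..nsv}. \<sigma> i \<in> {a, b})
             \<and> \<L> = image_mset \<sigma> (mset_set {1..CARD('n)})
                   + image_mset (\<lambda>i. - \<sigma> i) (mset_set {1..CARD('n)})
                   + replicate_mset (CARD('m) - CARD('n)) 0
             \<and> (\<forall>i\<in>{1..nsv}. \<gamma> i = cj_fun A a b d (lscale A (\<sigma> i)))
             \<and> antimono_on {1..r} \<gamma>
             \<and> antimono_on {r+1..nsv} \<gamma>
             \<and> image_mset \<gamma> (mset_set {nsv+1..CARD('m) + CARD('n)})
                 = image_mset (\<lambda>x. cj_fun A a b d (lscale A x))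
                     (\<L> - image_mset \<sigma> (mset_set {1..nsv}))
             \<and> antimono_on {nsv+1..CARD('m) + CARD('n)} \<gamma>
             \<longrightarrow>
             antimono_on {1..CARD('m) + CARD('n)} \<gamma>
             \<and> (\<forall>i\<in>{1..r}. 1 \<ge> \<gamma> i \<and> \<gamma> i > 3 / 4)
             \<and> (\<forall>i\<in>{r+1..nsv}. 3 / 4 > \<gamma> i \<and> \<gamma> i > 1 / 4)
             \<and> (\<forall>i\<in>{nsv+1..CARD('m) + CARD('n)}. 1 / 4 > \<gamma> i \<and> \<gamma> i \<ge> 0)))"
proof -
  define S where "S = range (($) s)"
  define \<theta> where "\<theta> x = arccos (lscale A x)" for x
  define \<epsilon> where "\<epsilon> = pi ^ 6 / (2 * (real d + 2) ^ 3 * \<Delta>min ^ 4)"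
  define \<phi> where "\<phi> x = cj_fun A a b d (lscale A x)" for x
  have bA: "b \<le> norm2 A" using ab by auto
  have ab': "0 < a" "a < b" "b \<le> norm2 A" using ab bA by auto
  have S: "0 \<le> x" "x \<le> norm2 A" if "x \<in> S" for x
    using that svd singular_value_le_norm2[OF svd] by (auto simp: S_def is_svd_def)
  have il': "\<sigma>il \<in> S" "a < \<sigma>il" "\<sigma>il < b" "\<And>x. x \<in> S \<Longrightarrow> a < x \<Longrightarrow> x < b \<Longrightarrow> \<sigma>il \<le> x"
    using il by (force simp: is_arg_min_def S_def)+
  have ir': "\<sigma>ir \<in> S" "a < \<sigma>ir" "\<sigma>ir < b" "\<And>x. x \<in> S \<Longrightarrow> a < x \<Longrightarrow> x < b \<Longrightarrow> x \<le> \<sigma>ir"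
    using ir by (force simp: is_arg_min_def S_def)+
  have ol': "\<sigma>ol \<in> S" "\<sigma>ol < a" "\<And>x. x \<in> S \<Longrightarrow> x < a \<Longrightarrow> x \<le> \<sigma>ol"
    using ol by (force simp: is_arg_min_def S_def)+
  have or': "\<sigma>or \<in> S" "b < \<sigma>or" "\<And>x. x \<in> S \<Longrightarrow> b < x \<Longrightarrow> \<sigma>or \<le> x"
    using or by (force simp: is_arg_min_def S_def)+
  have less: "\<theta> y < \<theta> x" if "- norm2 A \<le> x" "x < y" "y \<le> norm2 A" for x y
    unfolding \<theta>_def using that ab'
    by (intro arccos_less_arccos) (auto simp: lscale_def field_simps divide_strict_right_mono)
  have le: "\<theta> y \<le> \<theta> x" if "- norm2 A \<le> x" "x \<le> y" "y \<le> norm2 A" for x y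
    using less[of x y] that by (cases "x = y") auto
  have gaps: "\<Delta>il = \<theta> a - \<theta> \<sigma>il" "\<Delta>ir = \<theta> \<sigma>ir - \<theta> b" "\<Delta>ol = \<theta> \<sigma>ol - \<theta> a" "\<Delta>or = \<theta> b - \<theta> \<sigma>or"
    and gaps_pos: "0 < \<Delta>il" "0 < \<Delta>ir" "0 < \<Delta>ol" "0 < \<Delta>or"
    using less[of a \<sigma>il] less[of \<sigma>ir b] less[of \<sigma>ol a] less[of b \<sigma>or] il' ir' ol' or' ab' S
    unfolding \<Delta>il \<Delta>ir \<Delta>ol \<Delta>or \<alpha> \<beta> \<theta>_def[symmetric] by force+
  have D: "0 < \<Delta>min" "\<Delta>min \<le> \<Delta>il" "\<Delta>min \<le> \<Delta>ir" "\<Delta>min \<le> \<Delta>ol" "\<Delta>min \<le> \<Delta>or"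
    using gaps_pos by (auto simp: \<Delta>min)
  have spec_abs: "\<bar>x\<bar> \<le> norm2 A" if "x \<in> S \<or> - x \<in> S \<or> x = 0" for x
    using that S[of x] S[of "- x"] ab' by force
  have err: "\<bar>step_weight a b x - \<phi> x\<bar> \<le> \<epsilon>" if x: "x \<in> S \<or> - x \<in> S \<or> x = 0" for x
    unfolding \<epsilon>_def \<phi>_def
  proof (rule cj_fun_step_error[OF ab' spec_abs[OF x]])
    show "0 < \<Delta>min" by (rule D)
    \<comment> \<open>The singular value \<open>\<sigma>il\<close> lies strictly between the jumps, so the arc is longer than \<open>\<Delta>il\<close>.\<close>
    have "\<theta> b < \<theta> \<sigma>il" using less[of \<sigma>il b] il' ab' by force
    then show "\<Delta>min \<le> arccos (lscale A a) - arccos (lscale A b)"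
      using D gaps by (simp add: \<theta>_def[symmetric])
    \<comment> \<open>The singular value \<open>\<sigma>or\<close> beyond \<open>b\<close> keeps \<open>\<beta>\<close> away from \<open>0\<close>.\<close>
    have "0 \<le> \<theta> \<sigma>or"
      unfolding \<theta>_def
    proof (rule arccos_lbound)
      have "0 \<le> lscale A \<sigma>or" using S(1)[OF or'(1)] ab' by (simp add: lscale_def)
      then show "- 1 \<le> lscale A \<sigma>or" by simp
      show "lscale A \<sigma>or \<le> 1" using S(2)[OF or'(1)] ab' by (simp add: lscale_def)
    qed
    then show "\<Delta>min \<le> arccos (lscale A b)" using D gaps by (simp add: \<theta>_def[symmetric])
    show "\<Delta>min \<le> arccos (lscale A x) - arccos (lscale A a)" if "x < a"
    proof -
      \<comment> \<open>Zeros and negated singular values lie below \<open>\<sigma>ol\<close> because \<open>\<sigma>ol \<ge> 0\<close>.\<close>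
      have "x \<le> \<sigma>ol"
        using x ol'(3)[of x] S[of "- x"] S(1)[OF ol'(1)] that by force
      then have "\<theta> \<sigma>ol \<le> \<theta> x" using le[of x \<sigma>ol] spec_abs[OF x] S ol' by force
      then show ?thesis using D gaps by (simp add: \<theta>_def[symmetric])
    qed
    have pos: "x \<in> S" if "0 < x" using x that S[of "- x"] by force
    show "\<Delta>min \<le> arccos (lscale A a) - arccos (lscale A x)
        \<and> \<Delta>min \<le> arccos (lscale A x) - arccos (lscale A b)" if "a < x" "x < b"
    proof -
      have "x \<in> S" using pos that ab' by simp
      then have "\<theta> x \<le> \<theta> \<sigma>il" "\<theta> \<sigma>ir \<le> \<theta> x"
        using le[of \<sigma>il x] le[of x \<sigma>ir] il' ir' S that ab' by force+
      then show ?thesis using D gaps by (simp add: \<theta>_def[symmetric])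
    qed
    show "\<Delta>min \<le> arccos (lscale A b) - arccos (lscale A x)" if "b < x"
    proof -
      have "x \<in> S" using pos that ab' by simp
      then have "\<theta> x \<le> \<theta> \<sigma>or" using le[of \<sigma>or x] or' S that ab' by force
      then show ?thesis using D gaps by (simp add: \<theta>_def[symmetric])
    qed
  qed
  have bound: "norm2 (spectral_projector U \<iota> s V a b - cj_mat A a b d) \<le> \<epsilon>"
  proof (rule norm2_le_of_orthonormal_eigenvectors)
    show "orthogonal_matrix (Qmat U \<iota> V)" using svd by (simp add: is_svd_def orthogonal_matrix_Qmat)
    fix k
    show "(spectral_projector U \<iota> s V a b - cj_mat A a b d) *v column k (Qmat U \<iota> V)
      = (step_weight a b (Qeig \<iota> s $ k) - \<phi> (Qeig \<iota> s $ k)) *\<^sub>R column k (Qmat U \<iota> V)"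
      by (simp add: matrix_vector_mult_diff_rdistrib spectral_projector_eigenvector[OF svd ab(2)]
          cj_mat_eigenvector[OF augmented_eigenvector[OF svd]] \<phi>_def scaleR_left_diff_distrib)
    have inj: "inj \<iota>" using svd by (simp add: is_svd_def)
    show "\<bar>step_weight a b (Qeig \<iota> s $ k) - \<phi> (Qeig \<iota> s $ k)\<bar> \<le> \<epsilon>"
      by (rule err, cases k rule: block_index_cases[where \<iota> = \<iota>]) (auto simp: S_def Qeig_entries[OF inj])
  qed
  have chain: "antimono_on {1..CARD('m) + CARD('n)} \<gamma>
      \<and> (\<forall>i\<in>{1..r}. 1 \<ge> \<gamma> i \<and> \<gamma> i > 3 / 4)
      \<and> (\<forall>i\<in>{r+1..nsv}. 3 / 4 > \<gamma> i \<and> \<gamma> i > 1 / 4)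
      \<and> (\<forall>i\<in>{nsv+1..CARD('m) + CARD('n)}. 1 / 4 > \<gamma> i \<and> \<gamma> i \<ge> 0)"
    if "\<epsilon> < 1 / 4"
      "image_mset \<sigma> (mset_set {1..CARD('n)}) = image_mset (($) s) (mset_set UNIV)"
      "r \<le> nsv" "nsv \<le> CARD('n)"
      "\<forall>i\<in>{1..CARD('n)}. \<sigma> i \<in> {a..b} \<longleftrightarrow> i \<le> nsv"
      "\<forall>i\<in>{1..r}. \<sigma> i \<in> {a<..<b}" "\<forall>i\<in>{r+1..nsv}. \<sigma> i \<in> {a, b}"
      "\<L> = image_mset \<sigma> (mset_set {1..CARD('n)}) + image_mset (\<lambda>i. - \<sigma> i) (mset_set {1..CARD('n)})
         + replicate_mset (CARD('m) - CARD('n)) 0"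
      "\<forall>i\<in>{1..nsv}. \<gamma> i = cj_fun A a b d (lscale A (\<sigma> i))"
      "antimono_on {1..r} \<gamma>" "antimono_on {r+1..nsv} \<gamma>"
      "image_mset \<gamma> (mset_set {nsv+1..CARD('m) + CARD('n)})
         = image_mset (\<lambda>x. cj_fun A a b d (lscale A x)) (\<L> - image_mset \<sigma> (mset_set {1..nsv}))"
      "antimono_on {nsv+1..CARD('m) + CARD('n)} \<gamma>"
    for \<sigma> \<gamma> :: "nat \<Rightarrow> real" and r nsv :: nat and \<L> :: "real multiset"
  proof (rule sorted_eigenvalues_chain[OF _ that(3-8) that(9)[folded \<phi>_def] that(10,11) that(12)[folded \<phi>_def] that(13) _ ab(1,2)])
    show "\<sigma> ` {1..CARD('n)} = S" using arg_cong[OF that(2), of set_mset] by (simp add: S_def)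
    show "0 \<le> x" if "x \<in> S" for x using S that by simp
    show "0 \<le> \<phi> x \<and> \<phi> x \<le> 1 \<and> \<bar>step_weight a b x - \<phi> x\<bar> < 1 / 4"
      if x: "x \<in> S \<or> - x \<in> S \<or> x = 0" for x
      using err[OF x] \<open>\<epsilon> < 1 / 4\<close> cj_fun_range[OF ab' spec_abs[OF x], of d] by (simp add: \<phi>_def)
  qed
  have quarter: "\<epsilon> < 1 / 4" if "real d > root 3 2 * pi\<^sup>2 / \<Delta>min powr (4 / 3) - 2"
    unfolding \<epsilon>_def by (rule error_bound_less_quarter[OF D(1) that])
  show ?thesis
  proof (rule conjI[OF _ impI[OF conjI]])
    show "norm2 (spectral_projector U \<iota> s V a b - cj_mat A a b d)
        \<le> pi ^ 6 / (2 * (real d + 2) ^ 3 * \<Delta>min ^ 4)"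
      using bound by (simp only: \<epsilon>_def)
    show "norm2 (spectral_projector U \<iota> s V a b - cj_mat A a b d) < 1 / 4"
      if "real d > root 3 2 * pi\<^sup>2 / \<Delta>min powr (4 / 3) - 2"
      using bound quarter[OF that] by simp
  qed (intro allI impI, elim conjE, rule chain[OF quarter], assumption+)
qed

end
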